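(* Let $\{f_1,\dots,f_s\}$ be a strongly generic set of forms in $R=\mathbb{K}[x_0,\dots,x_n]$, and let $a,m_1,\dots,m_s$ be positive integers with $a\le m_1+\cdots+m_s$. Then $$I_a(f_1^{m_1}\cdots f_s^{m_s})=\bigcap_{c=1}^{s}\left(\bigcap_{1\le i_1<\cdots<i_c\le s}\langle f_{i_1},\dots,f_{i_c}\rangle^{\mu_a(i_1,\dots,i_c)}\right)$$ and $$I_{a+1}(f_1^{m_1}\cdots f_{s-1}^{m_{s-1}}f_s^{m_s+1}):f_s=I_a(f_1^{m_1}\cdots f_{s-1}^{m_{s-1}}f_s^{m_s}).$$ Furthermore, the ideal $I_a(f_1^{m_1}\cdots f_s^{m_s})$ has a Koszul stranded Betti table.
   Context: $\mathbb{K}$ is an infinite field and $R=\mathbb{K}[x_0,\dots,x_n]$ is standard graded; a form is a homogeneous polynomial of positive degree. A set of forms in $R$ is generic if every subset of size at most $n+1$ forms an $R$-regular sequence. A set $\{f_1,\dots,f_s\}$ of forms of a common degree is strongly generic if it is generic and $\dim_{\mathbb{K}}(\mathbb{K}f_1+\cdots+\mathbb{K}f_s)=n+1$ (so $s\ge n+1$). The $a$-fold product ideal is $I_a(f_1^{m_1}\cdots f_s^{m_s})=\langle f_1^{n_1}\cdots f_s^{n_s}: 0\le n_i\le m_i \text{ for each } i,\ \sum_i n_i=a\rangle$. Put $\mu_a(i_1,\dots,i_c)=\max\{0,\ a-\sum_{j\in[s]\setminus\{i_1,\dots,i_c\}}m_j\}$ where $[s]=\{1,\dots,s\}$; an ideal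 raised to the power $0$ is $R$. A homogeneous ideal $I\subset R$ generated in degrees $1\le n_1<\cdots<n_r$ has a Koszul stranded Betti table if there is a positive integer $d$ such that, for all $i\ge 1$, the graded Betti number $\beta_{i,j}(R/I)\neq 0$ only if $j\in\{n_h+d(i-1): h=1,\dots,r\}$. *)

theory Defs
  imports "HOL-Library.Poly_Mapping" "HOL-Library.Cardinality" "Jordan_Normal_Form.Matrix"
begin

section \<open>Ideals of a commutative ring\<close>

lemma module_times: "Modules.module ((*) :: 'a::comm_ring_1 \<Rightarrow> 'a \<Rightarrow> 'a)"
  by unfold_locales (simp_all add: algebra_simps)

definition ideal_gen :: "'a::comm_ring_1 set \<Rightarrow> 'a set"
  where "ideal_gen B = Modules.module.span (*) B"

definition ideal_mult :: "'a::comm_ring_1 set \<Rightarrow> 'a set \<Rightarrow> 'a set"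
  where "ideal_mult I J = ideal_gen {x * y |x y. x \<in> I \<and> y \<in> J}"

primrec ideal_power :: "'a::comm_ring_1 set \<Rightarrow> nat \<Rightarrow> 'a set"
  where
    "ideal_power I 0 = UNIV"
  | "ideal_power I (Suc k) = ideal_mult I (ideal_power I k)"

definition ideal_colon :: "'a::comm_ring_1 set \<Rightarrow> 'a \<Rightarrow> 'a set"
  where "ideal_colon I f = {g. g * f \<in> I}"

definition regular_sequence :: "'a::comm_ring_1 list \<Rightarrow> bool"
  where "regular_sequence xs \<longleftrightarrow>
    (\<forall>i<length xs. \<forall>g. g * xs ! i \<in> ideal_gen (set (take i xs)) \<longrightarrow>
                        g \<in> ideal_gen (set (take i xs))) \<and>
    ideal_gen (set xs) \<noteq> UNIV"


section \<open>The standard graded polynomial ring\<close>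

text \<open>
  The ring \<open>R = K[x\<^sub>0,\<dots>,x\<^sub>n]\<close> is the type \<open>('v, 'k) mpoly\<close> of finitely supported maps from
  monomials to coefficients; the finite type \<open>'v\<close> indexes the variables, so \<open>n + 1 = CARD('v)\<close>.
\<close>

type_synonym ('v, 'k) mpoly = "('v \<Rightarrow>\<^sub>0 nat) \<Rightarrow>\<^sub>0 'k"

definition monom_degree :: "('v::finite \<Rightarrow>\<^sub>0 nat) \<Rightarrow> nat"
  where "monom_degree t = (\<Sum>v\<in>UNIV. Poly_Mapping.lookup t v)"

text \<open>The zero polynomial is homogeneous of every degree.\<close>

definition homogeneous :: "nat \<Rightarrow> ('v::finite, 'k::zero) mpoly \<Rightarrow> bool"
  where "homogeneous d p \<longleftrightarrow> (\<forall>t\<in>Poly_Mapping.keys p. monom_degree t = d)"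

definition scale :: "'k::field \<Rightarrow> ('v::finite, 'k) mpoly \<Rightarrow> ('v, 'k) mpoly"
  where "scale c p = Poly_Mapping.single 0 c * p"

lemma vector_space_scale:
  "Vector_Spaces.vector_space (scale :: 'k::field \<Rightarrow> ('v::finite, 'k) mpoly \<Rightarrow> ('v, 'k) mpoly)"
proof
  show "scale (a + b) x = scale a x + scale b x" for a b :: 'k and x :: "('v, 'k) mpoly"
    by (simp add: scale_def single_add distrib_right)
  show "scale a (scale b x) = scale (a * b) x" for a b :: 'k and x :: "('v, 'k) mpoly"
    by (simp add: scale_def mult.assoc [symmetric] mult_single)
qed (simp_all add: scale_def distrib_left)


section \<open>Generic sets of forms\<close>

text \<open>
  A regular sequence of forms stays regular after any permutation, so for a set it does not matter
  which of its enumerations is required to be regular.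
\<close>

definition generic :: "('v::finite, 'k::field) mpoly set \<Rightarrow> bool"
  where "generic F \<longleftrightarrow>
    (\<forall>f\<in>F. \<exists>d>0. homogeneous d f) \<and>
    (\<forall>A\<subseteq>F. finite A \<and> card A \<le> CARD('v) \<longrightarrow>
      (\<exists>xs. distinct xs \<and> set xs = A \<and> regular_sequence xs))"

definition strongly_generic :: "('v::finite, 'k::field) mpoly set \<Rightarrow> bool"
  where "strongly_generic F \<longleftrightarrow>
    generic F \<and>
    (\<exists>d>0. \<forall>f\<in>F. homogeneous d f) \<and>
    Vector_Spaces.vector_space.dim scale F = CARD('v)"


section \<open>Fold products\<close>

definition fold_ideal ::
    "nat \<Rightarrow> (nat \<Rightarrow> 'a::comm_ring_1) \<Rightarrow> (nat \<Rightarrow> nat) \<Rightarrow> nat \<Rightarrow> 'a set"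
  where "fold_ideal s f m a =
    ideal_gen {\<Prod>i=1..s. f i ^ e i |e. (\<forall>i\<in>{1..s}. e i \<le> m i) \<and> (\<Sum>i=1..s. e i) = a}"

text \<open>Truncated subtraction on \<^typ>\<open>nat\<close> is the maximum with \<open>0\<close> in the definition of \<open>\<mu>\<^sub>a\<close>.\<close>

definition mu :: "nat \<Rightarrow> (nat \<Rightarrow> nat) \<Rightarrow> nat \<Rightarrow> nat set \<Rightarrow> nat"
  where "mu s m a A = a - (\<Sum>j\<in>{1..s} - A. m j)"


section \<open>Graded Betti numbers\<close>

text \<open>
  A minimal graded free resolution \<open>\<cdots> \<rightarrow> F\<^sub>2 \<rightarrow> F\<^sub>1 \<rightarrow> F\<^sub>0 = R \<rightarrow> R/I \<rightarrow> 0\<close> for a proper homogeneous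
  ideal \<open>I\<close>. The list \<open>ds i\<close> contains the degrees of the basis elements of \<open>F\<^sub>i\<close>, that is,
  \<open>F\<^sub>i = \<Oplus>\<^sub>q R(- ds i ! q)\<close>, and the matrix \<open>\<phi> i\<close> represents \<open>F\<^sub>i\<^sub>+\<^sub>1 \<rightarrow> F\<^sub>i\<close> with respect to these
  bases. The map being of degree 0 means that its entry at \<open>(p, q)\<close> is homogeneous of degree
  \<open>ds (i + 1) ! q - ds i ! p\<close>; minimality means that no entry has a constant term.
\<close>

definition minimal_graded_free_resolution ::
    "('v::finite, 'k::field) mpoly set \<Rightarrow> (nat \<Rightarrow> nat list) \<Rightarrow>
     (nat \<Rightarrow> ('v, 'k) mpoly mat) \<Rightarrow> bool"
  where "minimal_graded_free_resolution I ds \<phi> \<longleftrightarrow>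
    ds 0 = [0] \<and>
    (\<forall>i. \<phi> i \<in> carrier_mat (length (ds i)) (length (ds (Suc i)))) \<and>
    (\<forall>i. \<forall>p<length (ds i). \<forall>q<length (ds (Suc i)).
      (\<forall>t\<in>Poly_Mapping.keys (\<phi> i $$ (p, q)). monom_degree t + ds i ! p = ds (Suc i) ! q) \<and>
      Poly_Mapping.lookup (\<phi> i $$ (p, q)) 0 = 0) \<and>
    {(\<phi> 0 *\<^sub>v w) $ 0 |w. w \<in> carrier_vec (length (ds 1))} = I \<and>
    (\<forall>i. {v \<in> carrier_vec (length (ds (Suc i))). \<phi> i *\<^sub>v v = 0\<^sub>v (length (ds i))} =
         {\<phi> (Suc i) *\<^sub>v w |w. w \<in> carrier_vec (length (ds (Suc (Suc i))))})"

text \<open>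
  \<open>graded_betti I i j\<close> is \<open>\<beta>\<^sub>i\<^sub>,\<^sub>j(R/I)\<close>, the number of summands \<open>R(-j)\<close> of \<open>F\<^sub>i\<close>, for a proper
  homogeneous ideal \<open>I\<close>. It exists and does not depend on the minimal resolution.
\<close>

definition graded_betti :: "('v::finite, 'k::field) mpoly set \<Rightarrow> nat \<Rightarrow> nat \<Rightarrow> nat"
  where "graded_betti I i j =
    (THE b. \<exists>ds \<phi>. minimal_graded_free_resolution I ds \<phi> \<and> b = count_list (ds i) j)"

text \<open>
  \<open>N\<close> is exactly the set of degrees occurring in a minimal homogeneous generating set of \<open>I\<close>. It is
  determined by \<open>I\<close>; degrees of superfluous generators are not allowed in \<open>N\<close>. In particular \<open>I\<close> is
  a homogeneous ideal.
\<close>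

definition generated_in_degrees :: "('v::finite, 'k::field) mpoly set \<Rightarrow> nat set \<Rightarrow> bool"
  where "generated_in_degrees I N \<longleftrightarrow>
    (\<exists>G dg. finite G \<and> ideal_gen G = I \<and> (\<forall>H\<subset>G. ideal_gen H \<noteq> I) \<and>
            (\<forall>g\<in>G. homogeneous (dg g) g) \<and> dg ` G = N)"

definition koszul_stranded :: "('v::finite, 'k::field) mpoly set \<Rightarrow> bool"
  where "koszul_stranded I \<longleftrightarrow>
    (\<exists>N. generated_in_degrees I N \<and> N \<noteq> {} \<and> 0 \<notin> N \<and>
      (\<exists>d>0. \<forall>i\<ge>1. \<forall>j. graded_betti I i j \<noteq> 0 \<longrightarrow> j \<in> {h + d * (i - 1) |h. h \<in> N}))"

end

theory Submission
  imports Defs "Jordan_Normal_Form.Determinant"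
begin

text \<open>
  Any \<open>n + 1\<close> of the forms are a regular sequence in every order and span the same space as all
  of them; the ideal-theoretic part uses nothing else about \<open>R\<close>. Both the intersection formula and
  the resolution are proved modulo an ideal \<open>\<langle>C\<rangle>\<close> generated by some of the forms, by induction on
  the remaining ones: killing one more form \<open>s\<close> turns the statement for \<open>(S, C)\<close> into the one for
  \<open>(S - {s}, C \<union> {s})\<close>, while division by \<open>s\<close> lowers \<open>a\<close> and the multiplicity of \<open>s\<close>. The same
  recursion orders the generators so that each successive colon ideal is generated by some of the
  forms. Hence the ideal has linear quotients with Koszul colon ideals, and this property passes
  to the syzygies, with all degrees raised by the common degree \<open>d\<close>; iterating gives a minimal
  resolution with a single strand.
\<close>

section \<open>Ideals, their powers and fold products\<close>

text \<open>Regularity is available only while at most \<open>N\<close> = n + 1 forms are involved,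
  so each induction modulo \<open>C\<close> has to end at \<open>card C = N\<close>. There all forms
  lie in the ideal of \<open>C\<close>, and for positive \<open>a\<close> both sides collapse to it.
  The delicate point is division by \<open>s\<close> in the intersection of powers: if
  \<open>A\<close> and \<open>C\<close> together contain \<open>N\<close> or more forms,
  \<open>s\<close> need not be cancellable modulo the power of \<open>A\<close>. But then
  \<open>A\<close> and \<open>C\<close> generate all forms, so \<open>A\<close> can be exchanged for
  a set \<open>D\<close> that contains \<open>s\<close> and completes \<open>C\<close> to exactly
  \<open>N\<close> forms; there the division costs only one exponent. The same division yields the
  colon formula of the theorem. As the Betti numbers are given by a definite description, one
  resolution is not enough: all minimal resolutions must be shown to have the same degrees.\<close>

interpretation ring_module: Modules.module "(*) :: 'a::comm_ring_1 \<Rightarrow> 'a \<Rightarrow> 'a"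
  rewrites "Modules.module.span ((*) :: 'a \<Rightarrow> 'a \<Rightarrow> 'a) = ideal_gen"
  by (rule module_times) (simp add: ideal_gen_def fun_eq_iff)

text \<open>For the regular module the rule \<open>a * (b * x) = (a * b) * x\<close> loops together with
  associativity.\<close>

declare ring_module.scale_scale [simp del]

lemma ideal_gen_least: "X \<subseteq> ideal_gen Y \<Longrightarrow> ideal_gen X \<subseteq> ideal_gen Y"
  by (rule ring_module.span_minimal) auto

lemma ideal_gen_lincomb: "x \<in> ideal_gen X \<Longrightarrow> y \<in> ideal_gen X \<Longrightarrow> c * x + y \<in> ideal_gen X"
  by (intro ring_module.span_add ring_module.span_scale[of x X c])

lemma ideal_gen_mult_right: "x \<in> ideal_gen X \<Longrightarrow> x * c \<in> ideal_gen X"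
  by (simp add: ring_module.span_scale mult.commute[of x])

lemma ideal_gen_insertE:
  assumes "g \<in> ideal_gen (insert p X)"
  obtains r u where "g = p * r + u" "u \<in> ideal_gen X"
proof -
  from assms obtain k where "g - k * p \<in> ideal_gen X"
    by (auto simp: ring_module.span_breakdown_eq)
  then show ?thesis
    by (intro that[of k "g - k * p"]) (auto simp: algebra_simps)
qed

lemma ideal_gen_UnE:
  assumes "g \<in> ideal_gen (X \<union> Y)"
  obtains u v where "g = u + v" "u \<in> ideal_gen X" "v \<in> ideal_gen Y"
  using assms by (auto simp: ring_module.span_Un)

lemma ideal_gen_image_times:
  assumes "g \<in> ideal_gen ((*) p ` X)"
  obtains w where "g = p * w" "w \<in> ideal_gen X"
proof -
  have "g \<in> (*) p ` ideal_gen X"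
    using assms
  proof (induction rule: ring_module.span_induct_alt)
    case base
    show ?case by (rule image_eqI[of _ _ 0]) (auto simp: ring_module.span_zero)
  next
    case (step c x y)
    then obtain x' y' where "x = p * x'" "x' \<in> X" "y = p * y'" "y' \<in> ideal_gen X" by auto
    then have "c * x + y = p * (c * x' + y')" "c * x' + y' \<in> ideal_gen X"
      by (simp_all add: distrib_left mult.left_commute ideal_gen_lincomb[OF ring_module.span_base])
    then show ?case by blast
  qed
  then show ?thesis using that by auto
qed

lemma times_mem_ideal_gen_image: "w \<in> ideal_gen X \<Longrightarrow> p * w \<in> ideal_gen ((*) p ` X)"
proof (induction rule: ring_module.span_induct_alt)
  case (step c x y)
  then have "c * (p * x) + p * y \<in> ideal_gen ((*) p ` X)"
    by (intro ideal_gen_lincomb[OF ring_module.span_base] imageI)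
  then show ?case by (simp add: algebra_simps)
qed (simp add: ring_module.span_zero)

section \<open>Powers of an ideal, taken modulo a further ideal\<close>

primrec power_gens :: "'a::comm_ring_1 set \<Rightarrow> nat \<Rightarrow> 'a set" where
  "power_gens A 0 = {1}"
| "power_gens A (Suc k) = {x * y |x y. x \<in> A \<and> y \<in> power_gens A k}"

text \<open>Replaces the nested spans of \<open>ideal_power\<close> by a single one, so that later
  arguments only meet products of elements of \<open>A\<close>.\<close>

lemma ideal_power_ideal_gen: "ideal_power (ideal_gen A) k = ideal_gen (power_gens A k)"
proof (induction k)
  case 0
  have "g \<in> ideal_gen {1::'a}" for g
    using ring_module.span_scale[of 1 "{1}" g] by (simp add: ring_module.span_base)
  then show ?case by auto
next
  case (Suc k)
  have "x * y \<in> ideal_gen (power_gens A (Suc k))" if "x \<in> ideal_gen A" "y \<in> ideal_gen (power_gens A k)" for x y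
    using that(1)
  proof (induction rule: ring_module.span_induct_alt)
    case (step c x z)
    have "x * y \<in> ideal_gen ((*) x ` power_gens A k)"
      using that(2) by (rule times_mem_ideal_gen_image)
    moreover have "(*) x ` power_gens A k \<subseteq> power_gens A (Suc k)"
      using step(1) by auto
    ultimately have "x * y \<in> ideal_gen (power_gens A (Suc k))"
      using ring_module.span_mono by blast
    from ideal_gen_lincomb[OF this step(2), of c] show ?case
      by (simp only: distrib_right mult.assoc)
  qed (simp add: ring_module.span_zero)
  then have "{x * y |x y. x \<in> ideal_gen A \<and> y \<in> ideal_gen (power_gens A k)} \<subseteq> ideal_gen (power_gens A (Suc k))"
    by blast
  then have "ideal_gen {x * y |x y. x \<in> ideal_gen A \<and> y \<in> ideal_gen (power_gens A k)} \<subseteq> ideal_gen (power_gens A (Suc k))"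
    by (rule ideal_gen_least)
  moreover have "power_gens A (Suc k) \<subseteq> {x * y |x y. x \<in> ideal_gen A \<and> y \<in> ideal_gen (power_gens A k)}"
    using ring_module.span_superset[of A] ring_module.span_superset[of "power_gens A k"] by auto
  then have "ideal_gen (power_gens A (Suc k)) \<subseteq> ideal_gen {x * y |x y. x \<in> ideal_gen A \<and> y \<in> ideal_gen (power_gens A k)}"
    by (rule ring_module.span_mono)
  ultimately show ?case
    unfolding ideal_power.simps Suc ideal_mult_def by (rule equalityI)
qed

text \<open>The preimage in the ring of the \<open>k\<close>-th power of the ideal of
  \<open>A\<close> in the quotient modulo \<open>C\<close>. Keeping \<open>C\<close> among the
  generators avoids quotient rings.\<close>

definition ideal_power_plus :: "'a::comm_ring_1 set \<Rightarrow> 'a set \<Rightarrow> nat \<Rightarrow> 'a set"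
  where "ideal_power_plus A C k = ideal_gen (power_gens A k \<union> C)"

lemma ideal_power_plus_0 [simp]: "ideal_power_plus A C 0 = UNIV"
proof -
  have "g \<in> ideal_gen (insert 1 C)" for g :: 'a
    using ring_module.span_scale[of 1 "insert 1 C" g] by (simp add: ring_module.span_base)
  then show ?thesis by (auto simp: ideal_power_plus_def)
qed

lemmas ideal_power_plus_closed =
  ring_module.span_add[of _ "power_gens A k \<union> C" for A k C, folded ideal_power_plus_def]
  ring_module.span_diff[of _ "power_gens A k \<union> C" for A k C, folded ideal_power_plus_def]
  ring_module.span_scale[of _ "power_gens A k \<union> C" for A k C, folded ideal_power_plus_def]

lemma ideal_power_plus_lincomb:
  "x \<in> ideal_power_plus A C k \<Longrightarrow> y \<in> ideal_power_plus A C k \<Longrightarrow> c * x + y \<in> ideal_power_plus A C k"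
  unfolding ideal_power_plus_def by (rule ideal_gen_lincomb)

lemma power_gens_mono: "A \<subseteq> B \<Longrightarrow> power_gens A k \<subseteq> power_gens B k"
  by (induction k) auto

lemma ideal_gen_subset_ideal_power_plus: "ideal_gen C \<subseteq> ideal_power_plus A C k"
  unfolding ideal_power_plus_def by (intro ring_module.span_mono) auto

lemma ideal_power_plus_mono: "A \<subseteq> B \<Longrightarrow> C \<subseteq> D \<Longrightarrow> ideal_power_plus A C k \<subseteq> ideal_power_plus B D k"
  unfolding ideal_power_plus_def by (intro ring_module.span_mono Un_mono power_gens_mono)

text \<open>A factor \<open>z\<close>, wherever it occurs, can be moved to the front; products
  without it use \<open>A\<close> only.\<close>

lemma power_gens_Suc_insert: "power_gens (insert z A) (Suc k) \<subseteq> (*) z ` power_gens (insert z A) k \<union> power_gens A (Suc k)"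
proof (induction k)
  case (Suc k)
  show ?case
  proof
    fix g assume "g \<in> power_gens (insert z A) (Suc (Suc k))"
    then obtain x y where g: "g = x * y" "x \<in> insert z A" "y \<in> power_gens (insert z A) (Suc k)" by auto
    show "g \<in> (*) z ` power_gens (insert z A) (Suc k) \<union> power_gens A (Suc (Suc k))"
    proof (cases "x = z")
      case False
      then have x: "x \<in> A" using g by auto
      from Suc g(3) have "y \<in> (*) z ` power_gens (insert z A) k \<or> y \<in> power_gens A (Suc k)"
        by blast
      then show ?thesis
      proof
        assume "y \<in> (*) z ` power_gens (insert z A) k"
        then obtain y' where y': "y = z * y'" "y' \<in> power_gens (insert z A) k" by auto
        have "g = z * (x * y')" using g y' by (simp add: algebra_simps)
        moreover have "x * y' \<in> power_gens (insert z A) (Suc k)" using y' g(2) by auto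
        ultimately show ?thesis by blast
      next
        assume "y \<in> power_gens A (Suc k)"
        then have "g \<in> power_gens A (Suc (Suc k))" using x g by (subst power_gens.simps(2)) blast
        then show ?thesis by blast
      qed
    qed (use g in auto)
  qed
qed auto

text \<open>Isolates one generator: up to the power of the smaller set \<open>A\<close>, an element
  is divisible by \<open>z\<close> at the cost of one exponent. The colon computations below rest on
  this.\<close>

lemma ideal_power_plus_insertE:
  assumes "g \<in> ideal_power_plus (insert z A) C (Suc k)"
  obtains w v where "g = z * w + v" "w \<in> ideal_power_plus (insert z A) C k" "v \<in> ideal_power_plus A C (Suc k)"
proof -
  have "power_gens (insert z A) (Suc k) \<union> C \<subseteq> (*) z ` power_gens (insert z A) k \<union> (power_gens A (Suc k) \<union> C)"
    using power_gens_Suc_insert[of z A k] by blast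
  then have "g \<in> ideal_gen ((*) z ` power_gens (insert z A) k \<union> (power_gens A (Suc k) \<union> C))"
    using assms ring_module.span_mono unfolding ideal_power_plus_def by blast
  then obtain u v where u: "g = u + v" "u \<in> ideal_gen ((*) z ` power_gens (insert z A) k)"
    and v: "v \<in> ideal_power_plus A C (Suc k)"
    unfolding ideal_power_plus_def by (rule ideal_gen_UnE)
  from u(2) obtain w where w: "u = z * w" "w \<in> ideal_gen (power_gens (insert z A) k)"
    by (rule ideal_gen_image_times)
  have "ideal_gen (power_gens (insert z A) k) \<subseteq> ideal_power_plus (insert z A) C k"
    unfolding ideal_power_plus_def by (intro ring_module.span_mono) auto
  with u v w show ?thesis by (intro that[of w v]) auto
qed

lemma ideal_power_plus_times:
  assumes "X \<subseteq> ideal_gen (A \<union> C)" "x \<in> X" "y \<in> ideal_power_plus A C k"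
  shows "x * y \<in> ideal_power_plus A C (Suc k)"
proof -
  have A: "x * y \<in> ideal_power_plus A C (Suc k)" if "x \<in> A" for x
  proof -
    have "x * y \<in> ideal_gen ((*) x ` (power_gens A k \<union> C))"
      using assms(3) unfolding ideal_power_plus_def by (rule times_mem_ideal_gen_image)
    also have "\<dots> \<subseteq> ideal_power_plus A C (Suc k)"
      unfolding ideal_power_plus_def
    proof (rule ideal_gen_least)
      show "(*) x ` (power_gens A k \<union> C) \<subseteq> ideal_gen (power_gens A (Suc k) \<union> C)"
        using that by (fastforce intro: ring_module.span_base ring_module.span_scale[OF ring_module.span_base])
    qed
    finally show ?thesis .
  qed
  have "x \<in> ideal_gen (A \<union> C)" using assms by auto
  then show ?thesis
  proof (induction rule: ring_module.span_induct_alt)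
    case base
    show ?case by (simp add: ideal_power_plus_def ring_module.span_zero)
  next
    case (step c x z)
    have "x * y \<in> ideal_power_plus A C (Suc k)"
    proof (cases "x \<in> A")
      case False
      then have "x \<in> C" using step by auto
      then have "x * y \<in> ideal_gen C" by (intro ideal_gen_mult_right ring_module.span_base)
      then show ?thesis using ideal_gen_subset_ideal_power_plus by blast
    qed (rule A)
    then have "c * (x * y) + z * y \<in> ideal_power_plus A C (Suc k)"
      using step by (intro ideal_power_plus_lincomb)
    then show ?case by (simp add: algebra_simps)
  qed
qed

text \<open>Exchange of generators: applied in both directions, it makes the power modulo
  \<open>C\<close> depend only on the ideal generated by \<open>A\<close> and \<open>C\<close>. This
  is how one index set is traded for another.\<close>

lemma ideal_power_plus_subset:
  assumes "X \<subseteq> ideal_gen (A \<union> C)"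
  shows "ideal_power_plus X C k \<subseteq> ideal_power_plus A C k"
proof (induction k)
  case (Suc k)
  have "power_gens X k \<subseteq> ideal_power_plus X C k"
    by (auto simp: ideal_power_plus_def intro: ring_module.span_base)
  then have "power_gens X (Suc k) \<subseteq> ideal_power_plus A C (Suc k)"
    using Suc by (auto simp del: power_gens.simps(2) simp: power_gens.simps(2)[of X] intro!: ideal_power_plus_times[OF assms])
  moreover have "C \<subseteq> ideal_power_plus A C (Suc k)"
    by (auto simp: ideal_power_plus_def intro: ring_module.span_base)
  ultimately show ?case
    unfolding ideal_power_plus_def by (intro ideal_gen_least) auto
qed simp

lemma ideal_power_plus_antimono: "l \<le> k \<Longrightarrow> ideal_power_plus A C k \<subseteq> ideal_power_plus A C l"
proof (induction rule: dec_induct)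
  case (step k)
  have "power_gens A k \<subseteq> ideal_gen (power_gens A k)" by (rule ring_module.span_superset)
  then have "power_gens A (Suc k) \<subseteq> ideal_gen (power_gens A k)"
    by (auto intro!: ring_module.span_scale)
  also have "\<dots> \<subseteq> ideal_power_plus A C k"
    unfolding ideal_power_plus_def by (intro ring_module.span_mono) auto
  finally have "ideal_power_plus A C (Suc k) \<subseteq> ideal_power_plus A C k"
    unfolding ideal_power_plus_def
    by (intro ideal_gen_least) (auto intro: ring_module.span_base)
  then show ?case using step by blast
qed simp

lemma prod_power_mem_power_gens:
  assumes "finite A"
  shows "(\<Prod>x\<in>A. x ^ e x) \<in> power_gens A (\<Sum>x\<in>A. e x)"
  using assms
proof (induction A rule: finite_induct)
  case (insert z A)
  have "z ^ n * y \<in> power_gens (insert z A) (n + k)" if "y \<in> power_gens A k" for n k y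
  proof (induction n)
    case 0
    then show ?case using that power_gens_mono[of A "insert z A"] by auto
  next
    case (Suc n)
    then have "z * (z ^ n * y) \<in> power_gens (insert z A) (Suc (n + k))" by auto
    then show ?case by (simp only: power_Suc mult.assoc add_Suc)
  qed
  from this[OF insert.IH, of "e z"] show ?case using insert.hyps by simp
qed simp

section \<open>Fold products indexed by a set of forms\<close>

definition fold_gens :: "'a::comm_ring_1 set \<Rightarrow> ('a \<Rightarrow> nat) \<Rightarrow> nat \<Rightarrow> 'a set"
  where "fold_gens S m a = {\<Prod>x\<in>S. x ^ e x |e. (\<forall>x\<in>S. e x \<le> m x) \<and> (\<Sum>x\<in>S. e x) = a}"

lemma fold_gens_0: "finite S \<Longrightarrow> fold_gens S m 0 = {1}"
  by (auto simp: fold_gens_def intro!: exI[of _ "\<lambda>_. 0"])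

lemma fold_gens_empty: "a > 0 \<Longrightarrow> fold_gens {} m a = {}"
  by (auto simp: fold_gens_def)

lemma fold_gens_insert:
  assumes "finite S" "s \<notin> S"
  shows "fold_gens (insert s S) m a = (\<Union>k\<in>{..min (m s) a}. (*) (s ^ k) ` fold_gens S m (a - k))"
proof (intro equalityI subsetI)
  fix g assume "g \<in> fold_gens (insert s S) m a"
  then obtain e where e: "g = (\<Prod>x\<in>insert s S. x ^ e x)" "\<forall>x\<in>insert s S. e x \<le> m x"
    "(\<Sum>x\<in>insert s S. e x) = a" by (auto simp: fold_gens_def)
  show "g \<in> (\<Union>k\<in>{..min (m s) a}. (*) (s ^ k) ` fold_gens S m (a - k))"
  proof (rule UN_I[of "e s"])
    show "e s \<in> {..min (m s) a}" using e assms by auto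
    show "g \<in> (*) (s ^ e s) ` fold_gens S m (a - e s)"
      using e assms by (auto simp: fold_gens_def intro!: imageI)
  qed
next
  fix g assume "g \<in> (\<Union>k\<in>{..min (m s) a}. (*) (s ^ k) ` fold_gens S m (a - k))"
  then obtain k e where e: "k \<le> m s" "k \<le> a" "g = s ^ k * (\<Prod>x\<in>S. x ^ e x)" "\<forall>x\<in>S. e x \<le> m x"
    "(\<Sum>x\<in>S. e x) = a - k" by (auto simp: fold_gens_def)
  have *: "(\<Prod>x\<in>S. x ^ (e(s := k)) x) = (\<Prod>x\<in>S. x ^ e x)" "(\<Sum>x\<in>S. (e(s := k)) x) = (\<Sum>x\<in>S. e x)"
    using assms by (auto intro!: prod.cong sum.cong)
  show "g \<in> fold_gens (insert s S) m a"
    unfolding fold_gens_def mem_Collect_eq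
    by (rule exI[of _ "e(s := k)"], insert e assms *, simp)
qed

lemma fold_gens_cong: "(\<And>x. x \<in> S \<Longrightarrow> m x = m' x) \<Longrightarrow> fold_gens S m a = fold_gens S m' a"
  unfolding fold_gens_def by (intro Collect_cong ex_cong1) auto

text \<open>The exponent of \<open>s\<close> in a generator is positive or zero. The two cases match
  the two moves of the inductions, dividing by \<open>s\<close> and killing
  \<open>s\<close>.\<close>

lemma fold_gens_rec:
  assumes "finite S" "s \<in> S" "m s > 0" "a > 0"
  shows "fold_gens S m a =
    (*) s ` fold_gens S (m(s := m s - 1)) (a - 1) \<union> fold_gens (S - {s}) m a"
proof -
  define T where "T = S - {s}"
  have S: "S = insert s T" "s \<notin> T" "finite T" using assms by (auto simp: T_def)
  have c: "fold_gens T (m(s := m s - 1)) b = fold_gens T m b" for b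
    using S by (intro fold_gens_cong) auto
  define n where "n = min (m s - 1) (a - 1)"
  have "min (m s) a = Suc n" using assms by (simp add: n_def)
  then have n: "{..min (m s) a} = insert 0 (Suc ` {..n})"
    by (simp only: atMost_Suc_eq_insert_0)
  have eq: "(*) (s ^ Suc k) ` fold_gens T m (a - Suc k) = (*) s ` (*) (s ^ k) ` fold_gens T m (a - 1 - k)" for k
    by (simp add: image_image mult.assoc)
  have "fold_gens S m a = (\<Union>k\<in>insert 0 (Suc ` {..n}). (*) (s ^ k) ` fold_gens T m (a - k))"
    unfolding S(1) fold_gens_insert[OF S(3,2)] n ..
  also have "\<dots> = fold_gens T m a \<union> (\<Union>k\<in>{..n}. (*) (s ^ Suc k) ` fold_gens T m (a - Suc k))"
    by (auto simp del: power_Suc)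
  also have "\<dots> = fold_gens T m a \<union> (*) s ` (\<Union>k\<in>{..n}. (*) (s ^ k) ` fold_gens T m (a - 1 - k))"
    unfolding eq image_UN ..
  also have "(\<Union>k\<in>{..n}. (*) (s ^ k) ` fold_gens T m (a - 1 - k)) = fold_gens S (m(s := m s - 1)) (a - 1)"
    unfolding S(1) fold_gens_insert[OF S(3,2)] c n_def by simp
  finally show ?thesis by (auto simp: T_def)
qed

lemma fold_gens_remove:
  assumes "finite S" "s \<in> S" "m s = 0"
  shows "fold_gens S m a = fold_gens (S - {s}) m a"
  using fold_gens_insert[of "S - {s}" s m a] assms by (simp add: insert_absorb)

text \<open>The right-hand side of the intersection formula modulo \<open>C\<close>. The empty
  \<open>A\<close> is kept: its term is the ideal of \<open>C\<close> once \<open>a\<close> exceeds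
  the total multiplicity and the whole ring otherwise, so the formula holds for every
  \<open>a\<close>.\<close>

definition fold_bound :: "'a::comm_ring_1 set \<Rightarrow> 'a set \<Rightarrow> ('a \<Rightarrow> nat) \<Rightarrow> nat \<Rightarrow> 'a set"
  where "fold_bound S C m a = (\<Inter>A\<in>Pow S. ideal_power_plus A C (a - (\<Sum>x\<in>S - A. m x)))"

lemma fold_bound_closed:
  assumes "g \<in> fold_bound S C m a" "h \<in> fold_bound S C m a"
  shows "g - h \<in> fold_bound S C m a"
  using assms by (auto simp: fold_bound_def intro!: ideal_power_plus_closed(2))

text \<open>A generator takes at most \<open>m x\<close> factors from each \<open>x\<close> outside
  \<open>A\<close>; the rest of its \<open>a\<close> factors, at least as many as the exponent
  demands, come from \<open>A\<close>.\<close>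

lemma fold_ideal_subset_bound:
  assumes "finite S"
  shows "ideal_gen (fold_gens S m a \<union> C) \<subseteq> fold_bound S C m a"
proof -
  have "g \<in> ideal_power_plus A C (a - (\<Sum>x\<in>S - A. m x))" if g: "g \<in> fold_gens S m a" and A: "A \<subseteq> S" for g A
  proof -
    obtain e where e: "g = (\<Prod>x\<in>S. x ^ e x)" "\<forall>x\<in>S. e x \<le> m x" "(\<Sum>x\<in>S. e x) = a"
      using g by (auto simp: fold_gens_def)
    have fin: "finite A" "finite (S - A)" using assms A finite_subset by auto
    have "(\<Sum>x\<in>S - A. e x) \<le> (\<Sum>x\<in>S - A. m x)" using e by (intro sum_mono) auto
    moreover have "(\<Sum>x\<in>S. e x) = (\<Sum>x\<in>S - A. e x) + (\<Sum>x\<in>A. e x)"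
      using A assms by (intro sum.subset_diff) auto
    ultimately have "a - (\<Sum>x\<in>S - A. m x) \<le> (\<Sum>x\<in>A. e x)" using e by auto
    then have *: "ideal_power_plus A C (\<Sum>x\<in>A. e x) \<subseteq> ideal_power_plus A C (a - (\<Sum>x\<in>S - A. m x))"
      by (rule ideal_power_plus_antimono)
    have "(\<Prod>x\<in>A. x ^ e x) \<in> ideal_power_plus A C (\<Sum>x\<in>A. e x)"
      unfolding ideal_power_plus_def using prod_power_mem_power_gens[OF fin(1), of e]
      by (intro ring_module.span_base) auto
    with * have "(\<Prod>x\<in>S - A. x ^ e x) * (\<Prod>x\<in>A. x ^ e x) \<in> ideal_power_plus A C (a - (\<Sum>x\<in>S - A. m x))"
      by (intro ideal_power_plus_closed(3)) auto
    moreover have "g = (\<Prod>x\<in>S - A. x ^ e x) * (\<Prod>x\<in>A. x ^ e x)"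
      unfolding e(1) using A assms by (intro prod.subset_diff) auto
    ultimately show ?thesis by simp
  qed
  moreover have "C \<subseteq> ideal_power_plus A C k" for A k
    by (auto simp: ideal_power_plus_def intro: ring_module.span_base)
  ultimately have "fold_gens S m a \<union> C \<subseteq> ideal_power_plus A C (a - (\<Sum>x\<in>S - A. m x))" if "A \<subseteq> S" for A
    using that by blast
  then have "ideal_gen (fold_gens S m a \<union> C) \<subseteq> ideal_power_plus A C (a - (\<Sum>x\<in>S - A. m x))" if "A \<subseteq> S" for A
    using that unfolding ideal_power_plus_def by (intro ideal_gen_least)
  then show ?thesis unfolding fold_bound_def by blast
qed

section \<open>The intersection formula\<close>

text \<open>\<open>N\<close> stands for n + 1. The conditions speak of subsets, so they contain
  regularity in every order. The limit \<open>card C < N\<close> is natural: by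
  \<open>spanning\<close>, any further form already lies in the ideal of \<open>N\<close> of
  them.\<close>

locale generic_elements =
  fixes F :: "'a::comm_ring_1 set" and N :: nat
  assumes finite_elements: "finite F"
    and nonzerodivisor:
      "C \<subseteq> F \<Longrightarrow> z \<in> F - C \<Longrightarrow> card C < N \<Longrightarrow> z * g \<in> ideal_gen C \<Longrightarrow> g \<in> ideal_gen C"
    and spanning: "C \<subseteq> F \<Longrightarrow> card C = N \<Longrightarrow> F \<subseteq> ideal_gen C"
begin

lemma finite_subset_elements: "A \<subseteq> F \<Longrightarrow> finite A"
  using finite_elements finite_subset by blast

lemma spanning_ge:
  assumes "C \<subseteq> F" "N \<le> card C"
  shows "F \<subseteq> ideal_gen C"
proof -
  obtain D where "D \<subseteq> C" "card D = N"
    using obtain_subset_with_card_n[OF assms(2)] by metis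
  then have "F \<subseteq> ideal_gen D" using assms spanning by auto
  also have "\<dots> \<subseteq> ideal_gen C" using \<open>D \<subseteq> C\<close> by (rule ring_module.span_mono)
  finally show ?thesis .
qed

text \<open>Double induction on \<open>A\<close> and the exponent. Moving \<open>p\<close> from
  \<open>A\<close> into \<open>C\<close> gives \<open>g = p * g' + v'\<close>; cancelling
  \<open>p\<close> then shows that \<open>z * g'\<close> lies in the power with exponent one lower,
  where the inner induction applies.\<close>

lemma colon_power_plus:
  assumes "A \<union> C \<subseteq> F" "A \<inter> C = {}" "z \<in> F - (A \<union> C)" "card (A \<union> C) < N"
    and "z * g \<in> ideal_power_plus A C k"
  shows "g \<in> ideal_power_plus A C k"
proof -
  have "finite A" using assms finite_subset_elements by blast
  then show ?thesis
    using assms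
  proof (induction A arbitrary: C z g k rule: finite_induct)
    case empty
    show ?case
    proof (cases k)
      case (Suc k')
      then have "ideal_power_plus {} C k = ideal_gen C" by (simp add: ideal_power_plus_def)
      then show ?thesis using empty nonzerodivisor[of C z g] by auto
    qed simp
  next
    case (insert p A)
    have card: "card (insert p A \<union> C) < N" by fact
    have set_facts: "A \<union> insert p C \<subseteq> F" "A \<inter> insert p C = {}" "z \<in> F - (A \<union> insert p C)"
      "A \<union> C \<subseteq> F" "A \<inter> C = {}" "p \<in> F - (A \<union> C)"
      using insert.prems(1-3) insert.hyps(2) by auto
    show ?case
      using insert.prems(5)
    proof (induction k arbitrary: g)
      case (Suc k)
      have sub: "ideal_power_plus A C (Suc k) \<subseteq> ideal_power_plus (insert p A) C k"
        using ideal_power_plus_mono[of A "insert p A" C C k] ideal_power_plus_antimono[of k "Suc k" A C] by auto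
      have fin: "finite (insert p A \<union> C)" using insert.prems finite_subset_elements by blast
      obtain w v where w: "z * g = p * w + v" "w \<in> ideal_power_plus (insert p A) C k"
        "v \<in> ideal_power_plus A C (Suc k)"
        using Suc.prems by (rule ideal_power_plus_insertE)
      \<comment> \<open>With \<open>p\<close> moved into \<open>C\<close>, the summand
        \<open>p * w\<close> is harmless, and the outer induction applies to the smaller set
        \<open>A\<close>.\<close>
      have "p * w \<in> ideal_gen (insert p C)"
        by (intro ideal_gen_mult_right ring_module.span_base) simp
      then have mem: "z * g \<in> ideal_power_plus A (insert p C) (Suc k)"
        unfolding w(1)
        using w(3) ideal_power_plus_mono[of A A C "insert p C" "Suc k"]
          ideal_gen_subset_ideal_power_plus[of "insert p C" A "Suc k"]
        by (intro ideal_power_plus_closed(1)) auto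
      have "card (A \<union> insert p C) < N" using card by simp
      from insert.IH[OF set_facts(1-3) this mem]
      have "g \<in> ideal_gen (insert p (power_gens A (Suc k) \<union> C))"
        by (simp add: ideal_power_plus_def)
      then obtain g' v' where g: "g = p * g' + v'" "v' \<in> ideal_power_plus A C (Suc k)"
        unfolding ideal_power_plus_def by (rule ideal_gen_insertE)
      have "p * (z * g' - w) = v - z * v'"
        using w(1) unfolding g(1) by (simp add: algebra_simps)
      also have "\<dots> \<in> ideal_power_plus A C (Suc k)"
        using w(3) g(2) by (intro ideal_power_plus_closed)
      finally have mem: "p * (z * g' - w) \<in> ideal_power_plus A C (Suc k)" .
      have "card (A \<union> C) \<le> card (insert p A \<union> C)"
        using fin by (intro card_mono) auto
      with card have "card (A \<union> C) < N" by simp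
      \<comment> \<open>The outer induction is used a second time, now with \<open>p\<close> as the
        element to be cancelled.\<close>
      from insert.IH[OF set_facts(4-6) this mem] sub w(2) have "z * g' - w + w \<in> ideal_power_plus (insert p A) C k"
        by (intro ideal_power_plus_closed(1)) auto
      then have "z * g' \<in> ideal_power_plus (insert p A) C k" by simp
      then have "g' \<in> ideal_power_plus (insert p A) C k" by (rule Suc.IH)
      then have "p * g' \<in> ideal_power_plus (insert p A) C (Suc k)"
        by (intro ideal_power_plus_times[of "insert p A"]) (auto intro: ring_module.span_base)
      then show ?case
        unfolding g(1) using g(2) ideal_power_plus_mono[of A "insert p A" C C "Suc k"]
        by (intro ideal_power_plus_closed(1)) auto
    qed simp
  qed
qed

text \<open>Splitting off \<open>z\<close> gives \<open>z * g = z * w + v\<close> with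
  \<open>v\<close> in the power of \<open>A - {z}\<close>. There \<open>z\<close> can be cancelled,
  so \<open>g - w\<close> lies in that power. Since \<open>z\<close> has left the set,
  \<open>card (A \<union> C) = N\<close> is still allowed.\<close>

lemma colon_power_plus_self:
  assumes "A \<union> C \<subseteq> F" "A \<inter> C = {}" "z \<in> A" "card (A \<union> C) \<le> N"
    and "z * g \<in> ideal_power_plus A C (Suc k)"
  shows "g \<in> ideal_power_plus A C k"
proof -
  define A' where "A' = A - {z}"
  have A: "A = insert z A'" "z \<notin> A'" using assms by (auto simp: A'_def)
  obtain w v where w: "z * g = z * w + v" "w \<in> ideal_power_plus A C k" "v \<in> ideal_power_plus A' C (Suc k)"
    using assms(5) unfolding A by (rule ideal_power_plus_insertE)
  have "finite (A \<union> C)" "z \<notin> C" using assms finite_subset_elements by auto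
  then have "card (A' \<union> C) < card (A \<union> C)"
    using A by (intro psubset_card_mono) auto
  moreover have "z * (g - w) \<in> ideal_power_plus A' C (Suc k)"
    using w(1,3) by (simp add: algebra_simps)
  ultimately have "g - w \<in> ideal_power_plus A' C (Suc k)"
    by (rule_tac colon_power_plus[of A' C z]) (use assms A in auto)
  then have "g - w \<in> ideal_power_plus A C k"
    using ideal_power_plus_mono[of A' A C C k] ideal_power_plus_antimono[of k "Suc k" A' C] A by auto
  from ideal_power_plus_closed(1)[OF this w(2)] show ?thesis by simp
qed

text \<open>The terms of the intersection are divided one by one. If \<open>s\<close> is in
  \<open>A\<close>, the exponent drops together with \<open>a\<close>, unless it is already 0; if
  not, \<open>a\<close> and the multiplicity outside \<open>A\<close> drop together and the exponent
  stays. Sets \<open>A\<close> too large for regularity are handled through another set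
  \<open>D\<close>.\<close>

lemma colon_fold_bound:
  assumes "S \<union> C \<subseteq> F" "S \<inter> C = {}" "s \<in> S" "m s > 0" "a > 0" "card C < N"
    and g: "s * g \<in> fold_bound S C m a"
  shows "g \<in> fold_bound S C (m(s := m s - 1)) (a - 1)"
  unfolding fold_bound_def
proof (intro INT_I)
  let ?m = "m(s := m s - 1)"
  fix A assume "A \<in> Pow S"
  then have A: "A \<subseteq> S" by simp
  have fin: "finite (S \<union> C)" using assms finite_subset_elements by blast
  have sg: "s * g \<in> ideal_power_plus B C (a - (\<Sum>x\<in>S - B. m x))" if "B \<subseteq> S" for B
    using g that by (auto simp: fold_bound_def)
  show "g \<in> ideal_power_plus A C (a - 1 - (\<Sum>x\<in>S - A. ?m x))"
  proof (cases "card (A \<union> C) < N")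
    case True
    show ?thesis
    proof (cases "s \<in> A")
      case sA: True
      then have eq: "(\<Sum>x\<in>S - A. ?m x) = (\<Sum>x\<in>S - A. m x)" by (intro sum.cong) auto
      show ?thesis
      proof (cases "a - (\<Sum>x\<in>S - A. m x)")
        case (Suc k)
        then have "a - 1 - (\<Sum>x\<in>S - A. ?m x) = k" unfolding eq by simp
        moreover have "g \<in> ideal_power_plus A C k"
          by (rule colon_power_plus_self[of A C s]) (use sg[OF A] True A assms sA Suc in auto)
        ultimately show ?thesis by simp
      next
        case 0
        then have "a - 1 - (\<Sum>x\<in>S - A. ?m x) = 0" unfolding eq by simp
        then show ?thesis by simp
      qed
    next
      case sA: False
      have "(\<Sum>x\<in>S - A. m x) = m s + (\<Sum>x\<in>S - A - {s}. m x)"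
        using sA assms fin by (intro sum.remove) auto
      moreover have "(\<Sum>x\<in>S - A. ?m x) = ?m s + (\<Sum>x\<in>S - A - {s}. ?m x)"
        using sA assms fin by (intro sum.remove) auto
      moreover have "(\<Sum>x\<in>S - A - {s}. ?m x) = (\<Sum>x\<in>S - A - {s}. m x)"
        by (intro sum.cong) auto
      ultimately have "a - 1 - (\<Sum>x\<in>S - A. ?m x) = a - (\<Sum>x\<in>S - A. m x)"
        using assms by simp
      moreover have "g \<in> ideal_power_plus A C (a - (\<Sum>x\<in>S - A. m x))"
        by (rule colon_power_plus[of A C s]) (use sg[OF A] True A assms sA in auto)
      ultimately show ?thesis by simp
    qed
  next
    case False
    have "s \<notin> C" using assms by auto
    have "finite C" using fin by simp
    have "card (A \<union> C) \<le> card (S \<union> C)"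
      using fin A by (intro card_mono) auto
    with False have "N \<le> card (S \<union> C)" by simp
    \<comment> \<open>\<open>E\<close> completes \<open>s\<close> and \<open>C\<close> to exactly
      \<open>N\<close> forms, the largest number for which \<open>colon_power_plus_self\<close>
      cancels \<open>s\<close>.\<close>
    then have "N - card (insert s C) \<le> card (S \<union> C - insert s C)"
      using \<open>finite C\<close> by (subst card_Diff_subset) (use assms(3) in auto)
    then obtain E where E: "E \<subseteq> S \<union> C - insert s C" "card E = N - card (insert s C)" "finite E"
      by (rule obtain_subset_with_card_n)
    define D where "D = insert s E"
    have D: "D \<subseteq> S" "s \<in> D" using E assms by (auto simp: D_def)
    have "D \<union> C = E \<union> insert s C" by (auto simp: D_def)
    then have card: "card (D \<union> C) = N"
      using E \<open>finite C\<close> \<open>s \<notin> C\<close> assms(6) by (simp only:) (subst card_Un_disjoint, auto)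
    have sub: "X \<subseteq> ideal_gen (A \<union> C)" if "X \<subseteq> F" for X
      using that spanning_ge[of "A \<union> C"] False A assms by auto
    have "S \<subseteq> ideal_gen (D \<union> C)"
      using spanning[of "D \<union> C"] card D assms by auto
    \<comment> \<open>The term of \<open>S\<close> itself has exponent \<open>a\<close>, and
      \<open>D\<close> together with \<open>C\<close> generates all of \<open>S\<close>.\<close>
    then have "s * g \<in> ideal_power_plus D C a"
      using sg[of S] ideal_power_plus_subset[of S D C a] by auto
    then have sgD: "s * g \<in> ideal_power_plus D C (Suc (a - 1))" using assms by simp
    have "g \<in> ideal_power_plus D C (a - 1)"
      by (rule colon_power_plus_self[of D C s]) (use card D assms sgD in auto)
    \<comment> \<open>\<open>A\<close> and \<open>C\<close> contain at least \<open>N\<close> forms,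
      so their ideal contains \<open>D\<close>; and \<open>a - 1\<close> is at least the exponent
      wanted.\<close>
    then have "g \<in> ideal_power_plus A C (a - 1)"
      using ideal_power_plus_subset[OF sub, of D "a - 1"] D assms by auto
    then show ?thesis by (rule subsetD[OF ideal_power_plus_antimono[OF diff_le_self]])
  qed
qed

text \<open>Modulo \<open>s\<close>, an element \<open>g\<close> of the bound satisfies the bound
  for \<open>S - {s}\<close>, hence equals \<open>s * g' + u\<close> with \<open>u\<close> in the
  fold ideal. Then \<open>s * g'\<close> is in the bound too, and \<open>colon_fold_bound\<close>
  passes to \<open>g'\<close>. The measure drops through \<open>card S\<close> when \<open>s\<close>
  is killed and through the multiplicities when it is divided out.\<close>

lemma fold_bound_subset:
  assumes "S \<union> C \<subseteq> F" "S \<inter> C = {}" "card C \<le> N"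
  shows "fold_bound S C m a \<subseteq> ideal_gen (fold_gens S m a \<union> C)"
  using assms
proof (induction "card S + (\<Sum>x\<in>S. m x)" arbitrary: S C m a rule: less_induct)
  case less
  have fin: "finite S" using less.prems finite_subset_elements by blast
  consider "a = 0" | "a > 0" "card C = N" | "a > 0" "S = {}" | s where "a > 0" "card C < N" "s \<in> S"
    using less.prems by fastforce
  then show ?case
  proof cases
    case 1
    then show ?thesis
      using ideal_power_plus_0[of S C] fin
      by (simp add: fold_gens_0 ideal_power_plus_def)
  next
    case 2
    have "fold_bound S C m a \<subseteq> ideal_power_plus S C a" by (auto simp: fold_bound_def)
    also have "\<dots> \<subseteq> ideal_power_plus {} C a"
      using spanning[of C] 2 less.prems by (intro ideal_power_plus_subset) auto
    also have "\<dots> = ideal_gen C" using 2 by (cases a) (auto simp: ideal_power_plus_def)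
    also have "\<dots> \<subseteq> ideal_gen (fold_gens S m a \<union> C)" by (intro ring_module.span_mono) auto
    finally show ?thesis .
  next
    case 3
    then have "ideal_power_plus {} C a = ideal_gen C"
      by (cases a) (auto simp: ideal_power_plus_def)
    then show ?thesis using 3 by (simp add: fold_bound_def fold_gens_empty)
  next
    case (4 s)
    define T where "T = S - {s}"
    have T: "S = insert s T" "s \<notin> T" "finite T" using 4 fin by (auto simp: T_def)
    have size: "card T + (\<Sum>x\<in>T. m x) < card S + (\<Sum>x\<in>S. m x)"
      using T by simp
    show ?thesis
    proof (cases "m s = 0")
      case True
      have sum_eq: "(\<Sum>x\<in>S - A. m x) = (\<Sum>x\<in>T - A. m x)" if "A \<subseteq> T" for A
        using T True that by (subst T(1)) (auto simp: insert_Diff_if)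
      have "fold_bound S C m a \<subseteq> fold_bound T C m a"
        unfolding fold_bound_def by (intro INF_superset_mono) (use T sum_eq in auto)
      also have "\<dots> \<subseteq> ideal_gen (fold_gens T m a \<union> C)"
        using size less.prems T by (intro less.hyps) auto
      finally show ?thesis
        unfolding fold_gens_remove[where m=m, OF fin 4(3) True] T_def .
    next
      case False
      let ?m = "m(s := m s - 1)"
      have rec: "fold_gens S m a = (*) s ` fold_gens S ?m (a - 1) \<union> fold_gens T m a"
        unfolding T_def using False 4 fin by (intro fold_gens_rec) auto
      show ?thesis
      proof
        fix g assume g: "g \<in> fold_bound S C m a"
        have "g \<in> ideal_power_plus B (insert s C) (a - (\<Sum>x\<in>T - B. m x))" if "B \<subseteq> T" for B
        proof -
          \<comment> \<open>The bound modulo \<open>s\<close> at \<open>B\<close> is the old bound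
            at \<open>insert s B\<close>: the complement, and so the exponent, is the same, and
            moving \<open>s\<close> from the power into \<open>C\<close> only enlarges the
            ideal.\<close>
          have "insert s B \<in> Pow S" using that T(1) by blast
          with g have "g \<in> ideal_power_plus (insert s B) C (a - (\<Sum>x\<in>S - insert s B. m x))"
            unfolding fold_bound_def by (rule INT_D)
          moreover have "S - insert s B = T - B" using T by auto
          moreover have "ideal_power_plus (insert s B) C k \<subseteq> ideal_power_plus B (insert s C) k" for k
            using ideal_power_plus_mono[of "insert s B" "insert s B" C "insert s C" k]
              ideal_power_plus_subset[of "insert s B" B "insert s C" k] ring_module.span_superset[of "B \<union> insert s C"]
            by auto
          ultimately show ?thesis by auto
        qed
        then have "g \<in> fold_bound T (insert s C) m a" by (auto simp: fold_bound_def)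
        moreover have "fold_bound T (insert s C) m a \<subseteq> ideal_gen (fold_gens T m a \<union> insert s C)"
          using size less.prems T 4 finite_subset_elements[of C]
          by (intro less.hyps) (auto simp: card_insert_if)
        ultimately have "g \<in> ideal_gen (insert s (fold_gens T m a \<union> C))" by auto
        then obtain g' u where g': "g = s * g' + u" "u \<in> ideal_gen (fold_gens T m a \<union> C)"
          by (rule ideal_gen_insertE)
        have sub: "ideal_gen (fold_gens T m a \<union> C) \<subseteq> ideal_gen (fold_gens S m a \<union> C)"
          unfolding rec by (intro ring_module.span_mono) auto
        then have "u \<in> fold_bound S C m a"
          using g'(2) fold_ideal_subset_bound[OF fin, of m a C] by auto
        with g have "g - u \<in> fold_bound S C m a" by (intro fold_bound_closed)
        then have "s * g' \<in> fold_bound S C m a" by (simp add: g'(1))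
        then have "g' \<in> fold_bound S C ?m (a - 1)"
          using less.prems 4 False by (intro colon_fold_bound) auto
        moreover have "(\<Sum>x\<in>S. ?m x) < (\<Sum>x\<in>S. m x)"
          using fin 4 False by (intro sum_strict_mono_ex1) auto
        then have "fold_bound S C ?m (a - 1) \<subseteq> ideal_gen (fold_gens S ?m (a - 1) \<union> C)"
          using less.prems by (intro less.hyps) auto
        ultimately have "s * g' \<in> ideal_gen ((*) s ` (fold_gens S ?m (a - 1) \<union> C))"
          by (intro times_mem_ideal_gen_image) auto
        also have "\<dots> \<subseteq> ideal_gen (fold_gens S m a \<union> C)"
        proof (rule ideal_gen_least)
          show "(*) s ` (fold_gens S ?m (a - 1) \<union> C) \<subseteq> ideal_gen (fold_gens S m a \<union> C)"
            unfolding rec by (fastforce intro: ring_module.span_base ring_module.span_scale[OF ring_module.span_base])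
        qed
        finally show "g \<in> ideal_gen (fold_gens S m a \<union> C)"
          unfolding g'(1) using g'(2) sub by (intro ring_module.span_add) auto
      qed
    qed
  qed
qed

corollary fold_bound_eq:
  assumes "S \<union> C \<subseteq> F" "S \<inter> C = {}" "card C \<le> N"
  shows "fold_bound S C m a = ideal_gen (fold_gens S m a \<union> C)"
  using fold_bound_subset[OF assms] fold_ideal_subset_bound[of S m a C] finite_subset_elements[of S] assms
  by auto

lemma colon_fold_ideal:
  assumes "S \<union> C \<subseteq> F" "S \<inter> C = {}" "s \<in> S" "m s > 0" "a > 0" "card C < N"
    and "s * g \<in> ideal_gen (fold_gens S m a \<union> C)"
  shows "g \<in> ideal_gen (fold_gens S (m(s := m s - 1)) (a - 1) \<union> C)"
  using colon_fold_bound[of S C s m a g] assms by (simp add: fold_bound_eq)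

text \<open>The word linear is relative to \<open>F\<close>: colon ideals are generated by forms
  from \<open>F\<close>. The bound \<open>card D \<le> N\<close> makes every enumeration of
  \<open>D\<close> satisfy the cancellation property of a regular sequence.\<close>

definition linear_quotients :: "'a set \<Rightarrow> 'a list \<Rightarrow> bool"
  where "linear_quotients C gs \<longleftrightarrow>
    (\<forall>i<length gs. \<exists>D. C \<subseteq> D \<and> D \<subseteq> F \<and> card D \<le> N \<and>
      ideal_colon (ideal_gen (set (take i gs) \<union> C)) (gs ! i) = ideal_gen D)"

text \<open>Generators divisible by \<open>s\<close> go first. Their colon ideals are those of the
  list divided by \<open>s\<close>, since \<open>s\<close> is cancellable modulo \<open>C\<close>.
  For a later generator, all multiples of \<open>s\<close> in the fold ideal are already covered, so
  its colon ideal is the one computed modulo \<open>s\<close>, which the induction supplies.\<close>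

lemma linear_quotients_exist:
  assumes "S \<union> C \<subseteq> F" "S \<inter> C = {}" "card C \<le> N"
  shows "\<exists>gs. linear_quotients C gs \<and> set gs \<subseteq> fold_gens S m a \<and>
    ideal_gen (set gs \<union> C) = ideal_gen (fold_gens S m a \<union> C)"
  using assms
proof (induction "card S + (\<Sum>x\<in>S. m x)" arbitrary: S C m a rule: less_induct)
  case less
  have fin: "finite S" using less.prems finite_subset_elements by blast
  consider "a = 0" | "a > 0" "card C = N" | "a > 0" "S = {}" | s where "a > 0" "card C < N" "s \<in> S"
    using less.prems by fastforce
  then show ?case
  proof cases
    case 1
    have "linear_quotients C [1]"
      using less.prems by (auto simp: linear_quotients_def ideal_colon_def)
    then show ?thesis using 1 fin by (intro exI[of _ "[1]"]) (auto simp: fold_gens_0)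
  next
    case 2
    have "ideal_gen (fold_gens S m a \<union> C) \<subseteq> fold_bound S C m a"
      using fin by (rule fold_ideal_subset_bound)
    also have "\<dots> \<subseteq> ideal_power_plus S C a" by (auto simp: fold_bound_def)
    also have "\<dots> \<subseteq> ideal_power_plus {} C a"
      using spanning[of C] 2 less.prems by (intro ideal_power_plus_subset) auto
    also have "\<dots> = ideal_gen C" using 2 by (cases a) (auto simp: ideal_power_plus_def)
    finally have "ideal_gen (fold_gens S m a \<union> C) = ideal_gen C"
      using ring_module.span_mono[of C "fold_gens S m a \<union> C"] by auto
    then show ?thesis by (intro exI[of _ "[]"]) (auto simp: linear_quotients_def)
  next
    case 3
    then show ?thesis by (intro exI[of _ "[]"]) (auto simp: linear_quotients_def fold_gens_empty)
  next
    case (4 s)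
    define T where "T = S - {s}"
    have T: "S = insert s T" "s \<notin> T" "finite T" using 4 fin by (auto simp: T_def)
    have size: "card T + (\<Sum>x\<in>T. m x) < card S + (\<Sum>x\<in>S. m x)"
      using T by simp
    show ?thesis
    proof (cases "m s = 0")
      case True
      have "fold_gens S m a = fold_gens T m a"
        unfolding T_def using True 4 fin by (intro fold_gens_remove)
      moreover have "\<exists>gs. linear_quotients C gs \<and> set gs \<subseteq> fold_gens T m a \<and>
          ideal_gen (set gs \<union> C) = ideal_gen (fold_gens T m a \<union> C)"
        using size less.prems T by (intro less.hyps) auto
      ultimately show ?thesis by simp
    next
      case False
      let ?m = "m(s := m s - 1)"
      have rec: "fold_gens S m a = (*) s ` fold_gens S ?m (a - 1) \<union> fold_gens T m a"
        unfolding T_def using False 4 fin by (intro fold_gens_rec) auto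
      have "(\<Sum>x\<in>S. ?m x) < (\<Sum>x\<in>S. m x)"
        using fin 4 False by (intro sum_strict_mono_ex1) auto
      then have "\<exists>gs. linear_quotients C gs \<and> set gs \<subseteq> fold_gens S ?m (a - 1) \<and>
          ideal_gen (set gs \<union> C) = ideal_gen (fold_gens S ?m (a - 1) \<union> C)"
        using less.prems by (intro less.hyps) auto
      then obtain gs where gs: "linear_quotients C gs" "set gs \<subseteq> fold_gens S ?m (a - 1)"
        "ideal_gen (set gs \<union> C) = ideal_gen (fold_gens S ?m (a - 1) \<union> C)" by auto
      have "\<exists>hs. linear_quotients (insert s C) hs \<and> set hs \<subseteq> fold_gens T m a \<and>
          ideal_gen (set hs \<union> insert s C) = ideal_gen (fold_gens T m a \<union> insert s C)"
        using size less.prems T 4 finite_subset_elements[of C]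
        by (intro less.hyps) (auto simp: card_insert_if)
      then obtain hs where hs: "linear_quotients (insert s C) hs" "set hs \<subseteq> fold_gens T m a"
        "ideal_gen (set hs \<union> insert s C) = ideal_gen (fold_gens T m a \<union> insert s C)" by auto
      \<comment> \<open>The colon formula turns a multiple of \<open>s\<close> in the fold ideal
        into a combination of the first block and \<open>C\<close>.\<close>
      have times: "s * r \<in> ideal_gen ((*) s ` set gs \<union> C)"
        if "s * r \<in> ideal_gen (fold_gens S m a \<union> C)" for r
      proof -
        have "r \<in> ideal_gen (set gs \<union> C)"
          unfolding gs(3) using that less.prems 4 False by (intro colon_fold_ideal) auto
        then have "s * r \<in> ideal_gen ((*) s ` (set gs \<union> C))" by (rule times_mem_ideal_gen_image)
        also have "\<dots> \<subseteq> ideal_gen ((*) s ` set gs \<union> C)"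
        proof (rule ideal_gen_least)
          show "(*) s ` (set gs \<union> C) \<subseteq> ideal_gen ((*) s ` set gs \<union> C)"
            by (fastforce intro: ring_module.span_base ring_module.span_scale[OF ring_module.span_base])
        qed
        finally show ?thesis .
      qed
      have fold_mono: "ideal_gen (X \<union> C) \<subseteq> ideal_gen (fold_gens S m a \<union> C)" if "X \<subseteq> fold_gens S m a" for X
        using that by (intro ring_module.span_mono) auto
      have base: "x \<in> ideal_gen (fold_gens S m a \<union> C)" if "x \<in> fold_gens S m a" for x
        using that by (intro ring_module.span_base) auto
      let ?gs = "map ((*) s) gs @ hs"
      have subset: "set ?gs \<subseteq> fold_gens S m a" using gs(2) hs(2) unfolding rec by auto
      moreover have "ideal_gen (set ?gs \<union> C) = ideal_gen (fold_gens S m a \<union> C)"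
      proof
        show "ideal_gen (set ?gs \<union> C) \<subseteq> ideal_gen (fold_gens S m a \<union> C)"
          using subset by (rule fold_mono)
        have gens: "ideal_gen ((*) s ` set gs \<union> C) \<subseteq> ideal_gen (set ?gs \<union> C)"
          by (intro ring_module.span_mono) auto
        have "x \<in> ideal_gen (set ?gs \<union> C)" if x: "x \<in> fold_gens S m a" for x
        proof -
          consider y where "x = s * y" | "x \<in> fold_gens T m a" using x unfolding rec by auto
          then show ?thesis
          proof cases
            case (1 y)
            then show ?thesis using times[of y] base[OF x] gens by auto
          next
            case 2
            \<comment> \<open>\<open>hs\<close> generates only modulo \<open>s\<close>; the error
              \<open>s * r\<close> lies in the fold ideal and is absorbed by
              \<open>times\<close>.\<close>
            then have "x \<in> ideal_gen (fold_gens T m a \<union> insert s C)"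
              by (intro ring_module.span_base) auto
            then have "x \<in> ideal_gen (insert s (set hs \<union> C))"
              unfolding hs(3)[symmetric] by simp
            then obtain r u where r: "x = s * r + u" "u \<in> ideal_gen (set hs \<union> C)"
              by (rule ideal_gen_insertE)
            have "u \<in> ideal_gen (fold_gens S m a \<union> C)"
              using r(2) fold_mono[of "set hs"] subset by auto
            with base[OF x] have "x - u \<in> ideal_gen (fold_gens S m a \<union> C)"
              by (rule ring_module.span_diff)
            then have "s * r \<in> ideal_gen (set ?gs \<union> C)" using times[of r] gens by (auto simp: r(1))
            moreover have "u \<in> ideal_gen (set ?gs \<union> C)"
              using r(2) ring_module.span_mono[of "set hs \<union> C" "set ?gs \<union> C"] by auto
            ultimately show ?thesis unfolding r(1) by (rule ring_module.span_add)
          qed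
        qed
        then show "ideal_gen (fold_gens S m a \<union> C) \<subseteq> ideal_gen (set ?gs \<union> C)"
          by (intro ideal_gen_least) (auto intro: ring_module.span_base)
      qed
      moreover have "linear_quotients C ?gs"
        unfolding linear_quotients_def
      proof (intro allI impI)
        fix i assume i: "i < length ?gs"
        show "\<exists>D. C \<subseteq> D \<and> D \<subseteq> F \<and> card D \<le> N \<and>
          ideal_colon (ideal_gen (set (take i ?gs) \<union> C)) (?gs ! i) = ideal_gen D"
        proof (cases "i < length gs")
          case True
          let ?X = "set (take i gs)"
          have "x * (s * gs ! i) \<in> ideal_gen ((*) s ` ?X \<union> C) \<longleftrightarrow> x * gs ! i \<in> ideal_gen (?X \<union> C)" for x
          proof
            assume "x * (s * gs ! i) \<in> ideal_gen ((*) s ` ?X \<union> C)"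
            then obtain u v where u: "x * (s * gs ! i) = u + v" "u \<in> ideal_gen ((*) s ` ?X)" "v \<in> ideal_gen C"
              by (rule ideal_gen_UnE)
            obtain w where w: "u = s * w" "w \<in> ideal_gen ?X" using u(2) by (rule ideal_gen_image_times)
            have "s * (x * gs ! i - w) = v" using u(1) w(1) by (simp add: algebra_simps)
            then have "x * gs ! i - w \<in> ideal_gen C"
              using nonzerodivisor[of C s] u(3) less.prems 4 by auto
            then have "x * gs ! i - w \<in> ideal_gen (?X \<union> C)" "w \<in> ideal_gen (?X \<union> C)"
              using w(2) ring_module.span_mono[of C "?X \<union> C"] ring_module.span_mono[of ?X "?X \<union> C"] by auto
            from ring_module.span_add[OF this] show "x * gs ! i \<in> ideal_gen (?X \<union> C)" by simp
          next
            assume "x * gs ! i \<in> ideal_gen (?X \<union> C)"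
            then have "s * (x * gs ! i) \<in> ideal_gen ((*) s ` (?X \<union> C))" by (rule times_mem_ideal_gen_image)
            also have "\<dots> \<subseteq> ideal_gen ((*) s ` ?X \<union> C)"
            proof (rule ideal_gen_least)
              show "(*) s ` (?X \<union> C) \<subseteq> ideal_gen ((*) s ` ?X \<union> C)"
                by (fastforce intro: ring_module.span_base ring_module.span_scale[OF ring_module.span_base])
            qed
            finally show "x * (s * gs ! i) \<in> ideal_gen ((*) s ` ?X \<union> C)" by (simp add: mult.left_commute)
          qed
          then have "ideal_colon (ideal_gen (set (take i ?gs) \<union> C)) (?gs ! i) = ideal_colon (ideal_gen (?X \<union> C)) (gs ! i)"
            using True by (simp add: ideal_colon_def nth_append take_map)
          with gs(1) True show ?thesis by (simp add: linear_quotients_def)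
        next
          case False
          define j where "j = i - length gs"
          have j: "j < length hs" using i False by (simp add: j_def)
          let ?X = "set (take j hs)"
          have X: "?X \<subseteq> fold_gens S m a" using subset by (auto dest: in_set_takeD)
          have h: "hs ! j \<in> fold_gens S m a" using subset j by auto
          \<comment> \<open>The ideal before \<open>hs ! j\<close> contains the first block instead
            of \<open>s\<close>, yet by \<open>times\<close> the colon is the same as with
            \<open>s\<close> itself.\<close>
          have "x * hs ! j \<in> ideal_gen ((*) s ` set gs \<union> ?X \<union> C) \<longleftrightarrow> x * hs ! j \<in> ideal_gen (?X \<union> insert s C)" for x
          proof
            have "ideal_gen ((*) s ` set gs \<union> ?X \<union> C) \<subseteq> ideal_gen (?X \<union> insert s C)"
            proof (rule ideal_gen_least)
              show "(*) s ` set gs \<union> ?X \<union> C \<subseteq> ideal_gen (?X \<union> insert s C)"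
                by (auto intro: ring_module.span_base intro!: ideal_gen_mult_right[OF ring_module.span_base])
            qed
            then show "x * hs ! j \<in> ideal_gen (?X \<union> insert s C)"
              if "x * hs ! j \<in> ideal_gen ((*) s ` set gs \<union> ?X \<union> C)" using that by auto
          next
            assume "x * hs ! j \<in> ideal_gen (?X \<union> insert s C)"
            then have "x * hs ! j \<in> ideal_gen (insert s (?X \<union> C))" by simp
            then obtain r u where r: "x * hs ! j = s * r + u" "u \<in> ideal_gen (?X \<union> C)"
              by (rule ideal_gen_insertE)
            have "u \<in> ideal_gen (fold_gens S m a \<union> C)"
              using r(2) fold_mono[OF X] by auto
            with ring_module.span_scale[OF base[OF h], of x]
            have "x * hs ! j - u \<in> ideal_gen (fold_gens S m a \<union> C)"
              by (rule ring_module.span_diff)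
            then have "s * r \<in> ideal_gen ((*) s ` set gs \<union> C)" using times[of r] by (simp add: r(1))
            also have "\<dots> \<subseteq> ideal_gen ((*) s ` set gs \<union> ?X \<union> C)" by (intro ring_module.span_mono) auto
            finally show "x * hs ! j \<in> ideal_gen ((*) s ` set gs \<union> ?X \<union> C)"
              unfolding r(1) using r(2) ring_module.span_mono[of "?X \<union> C" "(*) s ` set gs \<union> ?X \<union> C"]
              by (intro ring_module.span_add) auto
          qed
          then have colon: "ideal_colon (ideal_gen (set (take i ?gs) \<union> C)) (?gs ! i) =
              ideal_colon (ideal_gen (?X \<union> insert s C)) (hs ! j)"
            using False by (simp add: ideal_colon_def nth_append j_def)
          from hs(1) j have "\<exists>D. insert s C \<subseteq> D \<and> D \<subseteq> F \<and> card D \<le> N \<and>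
              ideal_colon (ideal_gen (?X \<union> insert s C)) (hs ! j) = ideal_gen D"
            unfolding linear_quotients_def by blast
          then show ?thesis unfolding colon by blast
        qed
      qed
      ultimately show ?thesis by blast
    qed
  qed
qed

end

section \<open>Homogeneous components\<close>

definition hom_component :: "nat \<Rightarrow> ('v::finite, 'k::zero) mpoly \<Rightarrow> ('v, 'k) mpoly"
  where "hom_component n p = Abs_poly_mapping (\<lambda>t. Poly_Mapping.lookup p t when monom_degree t = n)"

lemma lookup_hom_component:
  "Poly_Mapping.lookup (hom_component n p) t = (Poly_Mapping.lookup p t when monom_degree t = n)"
proof -
  have "finite {t. (Poly_Mapping.lookup p t when monom_degree t = n) \<noteq> 0}"
    by (rule finite_subset[OF _ finite_lookup[of p]]) (auto simp: when_def)
  then show ?thesis unfolding hom_component_def by simp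
qed

lemma monom_degree_zero [simp]: "monom_degree 0 = 0"
  by (simp add: monom_degree_def)

lemma monom_degree_add: "monom_degree (s + t) = monom_degree s + monom_degree t"
  by (simp add: monom_degree_def lookup_add sum.distrib)

lemma homogeneous_iff_lookup:
  "homogeneous d p \<longleftrightarrow> (\<forall>t. Poly_Mapping.lookup p t \<noteq> 0 \<longrightarrow> monom_degree t = d)"
  by (auto simp: homogeneous_def in_keys_iff)

lemma homogeneous_zero [simp]: "homogeneous d 0"
  by (simp add: homogeneous_iff_lookup)

lemma homogeneous_one [simp]: "homogeneous 0 1"
  by (auto simp: homogeneous_iff_lookup lookup_one when_def)

lemma homogeneous_uminus: "homogeneous d p \<Longrightarrow> homogeneous d (- p :: ('v::finite, 'k::ab_group_add) mpoly)"
  by (simp add: homogeneous_iff_lookup)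

lemma homogeneous_mult:
  fixes p q :: "('v::finite, 'k::semiring_0) mpoly"
  assumes "homogeneous d p" "homogeneous e q"
  shows "homogeneous (d + e) (p * q)"
  using assms keys_mult[of p q] by (fastforce simp: homogeneous_def monom_degree_add)

lemma homogeneous_power:
  fixes p :: "('v::finite, 'k::comm_semiring_1) mpoly"
  shows "homogeneous d p \<Longrightarrow> homogeneous (d * n) (p ^ n)"
  by (induction n) (auto dest: homogeneous_mult)

lemma homogeneous_prod:
  fixes g :: "'b \<Rightarrow> ('v::finite, 'k::comm_semiring_1) mpoly"
  assumes "\<And>x. x \<in> A \<Longrightarrow> homogeneous (e x) (g x)"
  shows "homogeneous (\<Sum>x\<in>A. e x) (\<Prod>x\<in>A. g x)"
  using assms by (induction A rule: infinite_finite_induct) (auto intro: homogeneous_mult)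

lemma homogeneous_hom_component: "homogeneous n (hom_component n p)"
  by (simp add: homogeneous_iff_lookup lookup_hom_component)

lemma hom_component_homogeneous:
  "homogeneous d p \<Longrightarrow> hom_component n p = (if n = d then p else 0)"
  by (intro poly_mapping_eqI) (auto simp: lookup_hom_component homogeneous_iff_lookup when_def)

lemma hom_component_add:
  fixes p q :: "('v::finite, 'k::comm_monoid_add) mpoly"
  shows "hom_component n (p + q) = hom_component n p + hom_component n q"
  by (intro poly_mapping_eqI) (simp add: lookup_hom_component lookup_add when_add_distrib)

lemma hom_component_zero [simp]: "hom_component n 0 = 0"
  by (intro poly_mapping_eqI) (simp add: lookup_hom_component)

lemma hom_component_sum:
  fixes g :: "'b \<Rightarrow> ('v::finite, 'k::comm_monoid_add) mpoly"
  shows "hom_component n (\<Sum>x\<in>A. g x) = (\<Sum>x\<in>A. hom_component n (g x))"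
  by (induction A rule: infinite_finite_induct) (auto simp: hom_component_add)

lemma sum_hom_components:
  fixes p :: "('v::finite, 'k::comm_monoid_add) mpoly"
  shows "(\<Sum>n\<in>monom_degree ` Poly_Mapping.keys p. hom_component n p) = p"
proof (rule poly_mapping_eqI)
  fix t
  have "(\<Sum>n\<in>monom_degree ` Poly_Mapping.keys p. Poly_Mapping.lookup (hom_component n p) t) =
      (\<Sum>n\<in>monom_degree ` Poly_Mapping.keys p. if n = monom_degree t then Poly_Mapping.lookup p t else 0)"
    by (intro sum.cong) (auto simp: lookup_hom_component when_def)
  also have "\<dots> = Poly_Mapping.lookup p t"
    by (subst sum.delta) (auto simp: in_keys_iff image_iff)
  finally show "Poly_Mapping.lookup (\<Sum>n\<in>monom_degree ` Poly_Mapping.keys p. hom_component n p) t = Poly_Mapping.lookup p t"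
    by (simp add: lookup_sum)
qed

text \<open>Degrees are natural numbers, so components below the degree of \<open>g\<close> need the
  second clause instead of a negative shift.\<close>

lemma hom_component_mult:
  fixes p g :: "('v::finite, 'k::semiring_0) mpoly"
  assumes g: "homogeneous e g"
  shows "hom_component (n + e) (p * g) = hom_component n p * g"
    and "n < e \<Longrightarrow> hom_component n (p * g) = 0"
proof -
  let ?D = "monom_degree ` Poly_Mapping.keys p"
  have "hom_component k (p * g) = (\<Sum>i\<in>?D. hom_component k (hom_component i p * g))" for k
    unfolding hom_component_sum[symmetric] sum_distrib_right[symmetric] sum_hom_components ..
  then have eq: "hom_component k (p * g) = (\<Sum>i\<in>?D. if k = i + e then hom_component i p * g else 0)" for k
    by (simp add: hom_component_homogeneous[OF homogeneous_mult[OF homogeneous_hom_component g]])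
  show "hom_component n (p * g) = 0" if "n < e"
    using that unfolding eq by (intro sum.neutral) auto
  have "hom_component n p = 0" if "n \<notin> ?D"
    using that by (intro poly_mapping_eqI) (auto simp: lookup_hom_component when_def in_keys_iff image_iff)
  moreover have "hom_component (n + e) (p * g) = (\<Sum>i\<in>?D. if n = i then hom_component i p * g else 0)"
    unfolding eq by (intro sum.cong) auto
  ultimately show "hom_component (n + e) (p * g) = hom_component n p * g"
    by (auto simp: sum.delta)
qed

section \<open>Syzygies of columns with linear quotients\<close>

lemma sum_lessThan_add: "(\<Sum>t<m + (n :: nat). g t) = (\<Sum>t<m. g t) + (\<Sum>j<n. g (m + j) :: 'a::comm_monoid_add)"
  by (induction n) (simp_all add: add.assoc)

lemma ideal_gen_set_iff: "x \<in> ideal_gen (set ys) \<longleftrightarrow> (\<exists>b. x = (\<Sum>j<length ys. b j * ys ! j))"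
proof
  show "x \<in> ideal_gen (set ys) \<Longrightarrow> \<exists>b. x = (\<Sum>j<length ys. b j * ys ! j)"
  proof (induction ys arbitrary: x rule: rev_induct)
    case (snoc y ys)
    then have "x \<in> ideal_gen (insert y (set ys))" by simp
    then obtain r u where r: "x = y * r + u" "u \<in> ideal_gen (set ys)" by (rule ideal_gen_insertE)
    from snoc.IH[OF r(2)] obtain b where "u = (\<Sum>j<length ys. b j * ys ! j)" by auto
    then show ?case
      using r(1) by (intro exI[of _ "b(length ys := r)"]) (auto simp: nth_append algebra_simps intro!: sum.cong)
  qed simp
next
  assume "\<exists>b. x = (\<Sum>j<length ys. b j * ys ! j)"
  then show "x \<in> ideal_gen (set ys)"
    by (auto intro!: ring_module.span_sum ring_module.span_scale[OF ring_module.span_base])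
qed

text \<open>The cancellation part of \<open>regular_sequence\<close>, for forms of one degree.
  Prefixes inherit it, and prefixes generate the colon ideals of the new columns among the
  syzygies.\<close>

definition koszul_list :: "nat \<Rightarrow> ('v::finite, 'k::field) mpoly list \<Rightarrow> bool"
  where "koszul_list d ys \<longleftrightarrow> (\<forall>y\<in>set ys. homogeneous d y) \<and>
    (\<forall>j<length ys. \<forall>x. x * ys ! j \<in> ideal_gen (set (take j ys)) \<longrightarrow> x \<in> ideal_gen (set (take j ys)))"

text \<open>Linear quotients for the columns of a \<open>k\<close> by \<open>r\<close> matrix: each
  column has a colon ideal modulo the span of its predecessors. For \<open>k = 1\<close> this
  concerns a list of generators; larger \<open>k\<close> is what allows iteration.\<close>

definition column_quotients :: "nat \<Rightarrow> nat \<Rightarrow> nat \<Rightarrow> (nat \<Rightarrow> nat \<Rightarrow> ('v::finite, 'k::field) mpoly) \<Rightarrow> bool"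
  where "column_quotients d k r M \<longleftrightarrow>
    (\<forall>i<r. \<exists>ys. koszul_list d ys \<and>
      (\<forall>x. (\<exists>c. \<forall>p<k. x * M p i = (\<Sum>l<i. c l * M p l)) \<longleftrightarrow> x \<in> ideal_gen (set ys)))"

definition is_syzygy :: "nat \<Rightarrow> nat \<Rightarrow> (nat \<Rightarrow> nat \<Rightarrow> 'a::comm_ring_1) \<Rightarrow> (nat \<Rightarrow> 'a) \<Rightarrow> bool"
  where "is_syzygy k r M v \<longleftrightarrow> (\<forall>p<k. (\<Sum>q<r. v q * M p q) = 0)"

text \<open>Columns are added one at a time. The last entry of a syzygy lies in the colon ideal of
  the new column, generated by \<open>ys\<close>; lifting each \<open>ys ! j\<close> to a syzygy
  gives the new columns, and syzygies with last entry zero are old. The colon ideal of the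
  \<open>j\<close>-th lift is generated by \<open>take j ys\<close>: the last entries give one
  inclusion by regularity, and the Koszul relations between lifts, with last entry zero, give the
  other.\<close>

lemma syzygies_column_quotients:
  assumes "column_quotients d k r M"
    and "\<And>p q. p < k \<Longrightarrow> q < r \<Longrightarrow> homogeneous \<delta> (M p q)"
  shows "\<exists>r' M'. column_quotients d r r' M' \<and> (\<forall>q<r. \<forall>t<r'. homogeneous d (M' q t)) \<and>
    (\<forall>v. is_syzygy k r M v \<longleftrightarrow> (\<exists>w. \<forall>q<r. v q = (\<Sum>t<r'. w t * M' q t)))"
  using assms
proof (induction r)
  case 0
  show ?case
    by (intro exI[of _ 0] exI[of _ "\<lambda>_ _. 0"]) (simp add: column_quotients_def is_syzygy_def)
next
  case (Suc r)
  have "column_quotients d k r M" using Suc.prems by (simp add: column_quotients_def)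
  from Suc.IH[OF this] Suc.prems(2) obtain r' M' where cq: "column_quotients d r r' M'"
    and hom: "\<And>q t. q < r \<Longrightarrow> t < r' \<Longrightarrow> homogeneous d (M' q t)"
    and exact: "\<And>v. is_syzygy k r M v \<longleftrightarrow> (\<exists>w. \<forall>q<r. v q = (\<Sum>t<r'. w t * M' q t))"
    by auto
  obtain ys where ys: "koszul_list d ys"
    and colon: "\<And>x. (\<exists>c. \<forall>p<k. x * M p r = (\<Sum>l<r. c l * M p l)) \<longleftrightarrow> x \<in> ideal_gen (set ys)"
    using Suc.prems(1) by (auto simp: column_quotients_def)
  define n where "n = length ys"
  have "\<exists>c. (\<forall>p<k. ys ! j * M p r = (\<Sum>l<r. c l * M p l)) \<and> (\<forall>l. homogeneous d (c l))" if "j < n" for j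
  proof -
    have "ys ! j \<in> ideal_gen (set ys)" using that by (intro ring_module.span_base) (simp add: n_def)
    then obtain c where c: "\<And>p. p < k \<Longrightarrow> ys ! j * M p r = (\<Sum>l<r. c l * M p l)" using colon by blast
    \<comment> \<open>The columns have degree \<open>\<delta>\<close> and \<open>ys ! j\<close> has
      degree \<open>d\<close>, so the degree \<open>d\<close> parts of the coefficients suffice.
      This keeps the entries of the next matrix in degree \<open>d\<close>.\<close>
    have "ys ! j * M p r = (\<Sum>l<r. hom_component d (c l) * M p l)" if p: "p < k" for p
    proof -
      have "homogeneous d (ys ! j)" using ys \<open>j < n\<close> by (simp add: koszul_list_def n_def)
      then have "ys ! j * M p r = hom_component (d + \<delta>) (ys ! j * M p r)"
        using Suc.prems(2)[OF p] by (subst hom_component_homogeneous[OF homogeneous_mult]) auto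
      also have "\<dots> = (\<Sum>l<r. hom_component (d + \<delta>) (c l * M p l))"
        by (simp add: c[OF p] hom_component_sum)
      also have "\<dots> = (\<Sum>l<r. hom_component d (c l) * M p l)"
        using Suc.prems(2)[OF p] by (intro sum.cong hom_component_mult(1)) auto
      finally show ?thesis .
    qed
    then show ?thesis
      by (intro exI[of _ "\<lambda>l. hom_component d (c l)"]) (simp add: homogeneous_hom_component)
  qed
  then obtain c where c: "\<And>j p. j < n \<Longrightarrow> p < k \<Longrightarrow> ys ! j * M p r = (\<Sum>l<r. c j l * M p l)"
    and c_hom: "\<And>j l. j < n \<Longrightarrow> homogeneous d (c j l)" by metis
  \<comment> \<open>Old syzygies get a zero in row \<open>r\<close>; column \<open>r' + j\<close> is
    the relation that lifts \<open>ys ! j\<close>.\<close>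
  define M'' where "M'' q t =
    (if t < r' then if q < r then M' q t else 0
     else if q < r then - c (t - r') q else ys ! (t - r'))" for q t
  have syzygy: "(\<Sum>q<Suc r. M'' q t * M p q) = 0" if "t < r' + n" "p < k" for t p
  proof (cases "t < r'")
    case True
    have "is_syzygy k r M (\<lambda>q. M' q t)"
      unfolding exact using True by (intro exI[of _ "\<lambda>t'. if t' = t then 1 else 0"]) (simp add: if_distrib[of "\<lambda>x. x * _"] cong: if_cong)
    with True that show ?thesis by (simp add: is_syzygy_def M''_def)
  next
    case False
    then have "(\<Sum>q<Suc r. M'' q t * M p q) = - (\<Sum>q<r. c (t - r') q * M p q) + ys ! (t - r') * M p r"
      by (simp add: M''_def sum_negf)
    then show ?thesis using c[of "t - r'" p] that False by simp
  qed
  have M''_old: "(\<Sum>t<r'. w t * M'' q t) = (if q < r then \<Sum>t<r'. w t * M' q t else 0)" for w q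
    by (simp add: M''_def)
  have M''_new: "(\<Sum>j<i. w j * M'' q (r' + j)) =
      (if q < r then - (\<Sum>j<i. w j * c j q) else \<Sum>j<i. w j * ys ! j)" for w q i
    by (simp add: M''_def sum_negf)
  have exact': "is_syzygy k (Suc r) M v \<longleftrightarrow> (\<exists>w. \<forall>q<Suc r. v q = (\<Sum>t<r' + n. w t * M'' q t))" for v
  proof
    assume "\<exists>w. \<forall>q<Suc r. v q = (\<Sum>t<r' + n. w t * M'' q t)"
    then obtain w where w: "\<And>q. q < Suc r \<Longrightarrow> v q = (\<Sum>t<r' + n. w t * M'' q t)" by auto
    show "is_syzygy k (Suc r) M v"
      unfolding is_syzygy_def
    proof (intro allI impI)
      fix p assume p: "p < k"
      have "(\<Sum>q<Suc r. v q * M p q) = (\<Sum>q<Suc r. \<Sum>t<r' + n. w t * (M'' q t * M p q))"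
        by (intro sum.cong) (auto simp: w sum_distrib_right mult.assoc simp del: sum.lessThan_Suc)
      also have "\<dots> = (\<Sum>t<r' + n. w t * (\<Sum>q<Suc r. M'' q t * M p q))"
        unfolding sum_distrib_left by (rule sum.swap)
      also have "\<dots> = 0" using p syzygy by (intro sum.neutral ballI) (simp del: sum.lessThan_Suc)
      finally show "(\<Sum>q<Suc r. v q * M p q) = 0" .
    qed
  next
    assume v: "is_syzygy k (Suc r) M v"
    have v_eq: "(\<Sum>q<r. v q * M p q) = - (v r * M p r)" if "p < k" for p
      using v that by (simp add: is_syzygy_def eq_neg_iff_add_eq_0)
    have "\<forall>p<k. v r * M p r = (\<Sum>l<r. (- v l) * M p l)"
      using v_eq by (simp add: sum_negf)
    then have "v r \<in> ideal_gen (set ys)" using colon by (metis (no_types))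
    then obtain b where b: "v r = (\<Sum>j<n. b j * ys ! j)" unfolding ideal_gen_set_iff n_def by auto
    \<comment> \<open>Subtracting \<open>b j\<close> times each new column clears row
      \<open>r\<close>; the sign is plus because those columns contain \<open>- c j\<close>.\<close>
    have "is_syzygy k r M (\<lambda>q. v q + (\<Sum>j<n. b j * c j q))"
      unfolding is_syzygy_def
    proof (intro allI impI)
      fix p assume p: "p < k"
      have "(\<Sum>q<r. (v q + (\<Sum>j<n. b j * c j q)) * M p q) =
          (\<Sum>q<r. v q * M p q) + (\<Sum>q<r. \<Sum>j<n. b j * (c j q * M p q))"
        by (simp add: distrib_right sum.distrib sum_distrib_right mult.assoc)
      also have "(\<Sum>q<r. \<Sum>j<n. b j * (c j q * M p q)) = (\<Sum>j<n. b j * (\<Sum>q<r. c j q * M p q))"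
        unfolding sum_distrib_left by (rule sum.swap)
      also have "\<dots> = (\<Sum>j<n. b j * (ys ! j * M p r))"
        using c p by (intro sum.cong) auto
      also have "\<dots> = v r * M p r" by (simp add: b sum_distrib_right mult.assoc)
      finally show "(\<Sum>q<r. (v q + (\<Sum>j<n. b j * c j q)) * M p q) = 0"
        using v_eq[OF p] by simp
    qed
    then obtain w where w: "\<And>q. q < r \<Longrightarrow> v q + (\<Sum>j<n. b j * c j q) = (\<Sum>t<r'. w t * M' q t)"
      unfolding exact by auto
    show "\<exists>w. \<forall>q<Suc r. v q = (\<Sum>t<r' + n. w t * M'' q t)"
    proof (intro exI allI impI)
      fix q assume "q < Suc r"
      then consider "q < r" | "q = r" by linarith
      then show "v q = (\<Sum>t<r' + n. (if t < r' then w t else b (t - r')) * M'' q t)"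
        unfolding sum_lessThan_add
        by cases (simp_all add: M''_old M''_new b w[symmetric])
    qed
  qed
  have "column_quotients d (Suc r) (r' + n) M''"
    unfolding column_quotients_def
  proof (intro allI impI)
    fix i assume i: "i < r' + n"
    show "\<exists>zs. koszul_list d zs \<and>
      (\<forall>x. (\<exists>c. \<forall>p<Suc r. x * M'' p i = (\<Sum>l<i. c l * M'' p l)) \<longleftrightarrow> x \<in> ideal_gen (set zs))"
    proof (cases "i < r'")
      case True
      have "(\<forall>p<Suc r. x * M'' p i = (\<Sum>l<i. w l * M'' p l)) \<longleftrightarrow> (\<forall>p<r. x * M' p i = (\<Sum>l<i. w l * M' p l))" for x w
        using True by (auto simp: M''_def less_Suc_eq)
      then show ?thesis using cq True by (simp add: column_quotients_def)
    next
      case False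
      define j where "j = i - r'"
      have j: "i = r' + j" "j < n" using i False by (auto simp: j_def)
      let ?zs = "take j ys"
      have len: "length ?zs = j" using j by (simp add: n_def)
      have "koszul_list d ?zs"
        using ys unfolding koszul_list_def by (auto dest: in_set_takeD simp: min_def)
      moreover have "(\<exists>c. \<forall>p<Suc r. x * M'' p i = (\<Sum>l<i. c l * M'' p l)) \<longleftrightarrow> x \<in> ideal_gen (set ?zs)" for x
      proof
        assume "\<exists>c. \<forall>p<Suc r. x * M'' p i = (\<Sum>l<i. c l * M'' p l)"
        then obtain w where "x * M'' r i = (\<Sum>l<r' + j. w l * M'' r l)" using j by auto
        then have "x * ys ! j = (\<Sum>l<j. w (r' + l) * ys ! l)"
          unfolding sum_lessThan_add by (simp add: M''_old M''_new) (simp add: M''_def j)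
        also have "\<dots> = (\<Sum>l<length ?zs. w (r' + l) * ?zs ! l)" using len by simp
        finally have "x * ys ! j \<in> ideal_gen (set ?zs)"
          unfolding ideal_gen_set_iff by (intro exI[of _ "\<lambda>l. w (r' + l)"])
        then show "x \<in> ideal_gen (set ?zs)" using ys j by (auto simp: koszul_list_def n_def)
      next
        assume "x \<in> ideal_gen (set ?zs)"
        then obtain b where b: "x = (\<Sum>l<j. b l * ys ! l)"
          unfolding ideal_gen_set_iff len by auto
        \<comment> \<open>A combination of the Koszul relations between the \<open>j\<close>-th lift
          and the earlier ones, chosen so that row \<open>r\<close> cancels; it is therefore an old
          syzygy.\<close>
        let ?v = "\<lambda>q. x * M'' q i - (\<Sum>l<j. b l * ys ! j * M'' q (r' + l))"
        have "is_syzygy k (Suc r) M ?v"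
          unfolding exact'
        proof (intro exI allI impI)
          fix q assume "q < Suc r"
          define u where "u t = (if t = i then x else if r' \<le> t \<and> t < i then - b (t - r') * ys ! j else 0)" for t
          have "(\<Sum>t<r' + n. u t * M'' q t) = (\<Sum>t<i. u t * M'' q t) + u i * M'' q i"
          proof -
            have "(\<Sum>t<r' + n. u t * M'' q t) = (\<Sum>t<Suc i. u t * M'' q t)"
              using i by (intro sum.mono_neutral_right) (auto simp: u_def)
            then show ?thesis by simp
          qed
          then show "?v q = (\<Sum>t<r' + n. u t * M'' q t)"
            unfolding j(1) sum_lessThan_add by (simp add: u_def j sum_negf)
        qed
        moreover have vr: "?v r = 0"
          unfolding M''_new by (simp add: M''_def j b sum_distrib_left mult_ac)
        ultimately have "is_syzygy k r M ?v" by (simp add: is_syzygy_def)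
        then obtain w where w: "\<And>q. q < r \<Longrightarrow> ?v q = (\<Sum>t<r'. w t * M' q t)" unfolding exact by auto
        show "\<exists>c. \<forall>p<Suc r. x * M'' p i = (\<Sum>l<i. c l * M'' p l)"
        proof (intro exI allI impI)
          fix q assume "q < Suc r"
          then have "?v q = (\<Sum>t<r'. w t * M'' q t)"
            using w[of q] vr by (cases "q = r") (auto simp: M''_old)
          then show "x * M'' q i = (\<Sum>l<i. (if l < r' then w l else b (l - r') * ys ! j) * M'' q l)"
            unfolding j(1) sum_lessThan_add by (simp add: diff_eq_eq)
        qed
      qed
      ultimately show ?thesis by blast
    qed
  qed
  moreover have "homogeneous d (M'' q t)" if "q < Suc r" "t < r' + n" for q t
    using that hom[of q t] c_hom[of "t - r'" q] ys
    by (auto simp: M''_def koszul_list_def n_def intro!: homogeneous_uminus)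
  ultimately show ?case using exact' by blast
qed

section \<open>Uniqueness of graded Betti numbers\<close>

text \<open>If \<open>m < n\<close>, zero padding makes both matrices square. A left inverse is then
  two-sided, yet the product in the other order has a zero row.\<close>

lemma left_inverse_dim_le:
  fixes P Q :: "nat \<Rightarrow> nat \<Rightarrow> 'k::field"
  assumes "\<And>i i'. i < n \<Longrightarrow> i' < n \<Longrightarrow> (\<Sum>l<m. Q i l * P l i') = (if i = i' then 1 else 0)"
  shows "n \<le> m"
proof (rule ccontr)
  assume "\<not> n \<le> m"
  then have m: "m < n" by simp
  define A where "A = mat n n (\<lambda>(i, l). if l < m then Q i l else 0)"
  define B where "B = mat n n (\<lambda>(l, i). if l < m then P l i else 0)"
  have "A * B = 1\<^sub>m n"
  proof (rule eq_matI)
    fix i j assume ij: "i < dim_row (1\<^sub>m n :: 'k mat)" "j < dim_col (1\<^sub>m n :: 'k mat)"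
    then have "(A * B) $$ (i, j) = (\<Sum>l\<in>{0..<n}. if l < m then Q i l * P l j else 0)"
      by (auto simp: A_def B_def scalar_prod_def intro!: sum.cong)
    also have "\<dots> = (\<Sum>l<m. Q i l * P l j)"
      using m by (intro sum.mono_neutral_cong_right) auto
    finally show "(A * B) $$ (i, j) = 1\<^sub>m n $$ (i, j)" using assms ij by simp
  qed (auto simp: A_def B_def)
  then have "B * A = 1\<^sub>m n"
    by (intro mat_mult_left_right_inverse[of A n B]) (auto simp: A_def B_def)
  moreover have "(B * A) $$ (m, m) = 0"
    using m by (auto simp: A_def B_def scalar_prod_def intro!: sum.neutral)
  ultimately show False using m by simp
qed

text \<open>\<open>P\<close> respects degrees, so the left inverse relation restricts to the block
  of degree \<open>j\<close>, where the dimension bound applies.\<close>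

lemma count_list_le_left_inverse:
  fixes P Q :: "nat \<Rightarrow> nat \<Rightarrow> 'k::field" and rs rs' :: "'b list"
  assumes inv: "\<And>i i'. i < length rs \<Longrightarrow> i' < length rs \<Longrightarrow>
      (\<Sum>l<length rs'. Q i l * P l i') = (if i = i' then 1 else 0)"
    and P: "\<And>l i. l < length rs' \<Longrightarrow> i < length rs \<Longrightarrow> P l i \<noteq> 0 \<Longrightarrow> rs' ! l = rs ! i"
  shows "count_list rs j \<le> count_list rs' j"
proof -
  define A where "A = {i. i < length rs \<and> rs ! i = j}"
  define B where "B = {i. i < length rs' \<and> rs' ! i = j}"
  have fin: "finite A" "finite B" by (auto simp: A_def B_def)
  obtain f where f: "bij_betw f {0..<card A} A" using ex_bij_betw_nat_finite[OF fin(1)] ..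
  obtain g where g: "bij_betw g {0..<card B} B" using ex_bij_betw_nat_finite[OF fin(2)] ..
  have "card A \<le> card B"
  proof (rule left_inverse_dim_le)
    fix i i' assume i: "i < card A" "i' < card A"
    then have fA: "f i \<in> A" "f i' \<in> A" using f by (auto simp: bij_betw_def)
    have "(\<Sum>l<card B. Q (f i) (g l) * P (g l) (f i')) = (\<Sum>l\<in>B. Q (f i) l * P l (f i'))"
      using sum.reindex_bij_betw[OF g, of "\<lambda>l. Q (f i) l * P l (f i')"] by (simp add: lessThan_atLeast0)
    also have "\<dots> = (\<Sum>l<length rs'. Q (f i) l * P l (f i'))"
      using P fA by (intro sum.mono_neutral_left) (auto simp: A_def B_def)
    also have "\<dots> = (if f i = f i' then 1 else 0)" using inv fA by (auto simp: A_def)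
    also have "f i = f i' \<longleftrightarrow> i = i'" using f i by (auto simp: bij_betw_def inj_on_def)
    finally show "(\<Sum>l<card B. Q (f i) (g l) * P (g l) (f i')) = (if i = i' then 1 else 0)" .
  qed
  moreover have "count_list xs j = card {i. i < length xs \<and> xs ! i = j}" for xs :: "'b list"
    by (simp add: count_list_eq_length_filter length_filter_conv_card eq_commute)
  ultimately show ?thesis by (simp add: A_def B_def)
qed

text \<open>Exponents are nonnegative, so only constant terms multiply to a constant term. Thus
  \<open>lookup _ 0\<close> acts as reduction modulo the variables.\<close>

lemma lookup_mult_zero:
  fixes p q :: "('v::finite, 'k::semiring_0) mpoly"
  shows "Poly_Mapping.lookup (p * q) 0 = Poly_Mapping.lookup p 0 * Poly_Mapping.lookup q 0"
proof -
  have "0 = s + t \<longleftrightarrow> s = 0 \<and> t = 0" for s t :: "'v \<Rightarrow>\<^sub>0 nat"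
    by (auto simp: poly_mapping_eq_iff lookup_add fun_eq_iff)
  then have "(Poly_Mapping.lookup q t when 0 = s + t) = ((Poly_Mapping.lookup q t when t = 0) when s = 0)" for s t
    by (auto simp: when_def)
  then have "(\<Sum>t. Poly_Mapping.lookup q t when 0 = s + t) = (Poly_Mapping.lookup q 0 when s = 0)" for s
    by (cases "s = 0") simp_all
  then show ?thesis by (simp add: lookup_mult mult_when)
qed

lemma mat_lookup_mult_zero:
  fixes A B :: "('v::finite, 'k::semiring_0) mpoly mat"
  assumes "A \<in> carrier_mat n k" "B \<in> carrier_mat k c" "i < n" "j < c"
  shows "Poly_Mapping.lookup ((A * B) $$ (i, j)) 0 =
    (\<Sum>l<k. Poly_Mapping.lookup (A $$ (i, l)) 0 * Poly_Mapping.lookup (B $$ (l, j)) 0)"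
  using assms by (auto simp: scalar_prod_def lookup_sum lookup_mult_zero lessThan_atLeast0 intro!: sum.cong)

text \<open>Maps of degree 0 between graded free modules with basis degrees \<open>cs\<close> and
  \<open>rs\<close>. The additive form forces a zero entry when \<open>cs ! q < rs ! p\<close>,
  where truncated subtraction would admit a constant.\<close>

definition graded_mat :: "nat list \<Rightarrow> nat list \<Rightarrow> ('v::finite, 'k::field) mpoly mat \<Rightarrow> bool"
  where "graded_mat rs cs A \<longleftrightarrow> A \<in> carrier_mat (length rs) (length cs) \<and>
    (\<forall>p<length rs. \<forall>q<length cs. \<forall>t\<in>Poly_Mapping.keys (A $$ (p, q)). monom_degree t + rs ! p = cs ! q)"

text \<open>The degree \<open>n\<close> part of \<open>x\<close> as an element of R(-r).\<close>

definition shifted_component :: "nat \<Rightarrow> nat \<Rightarrow> ('v::finite, 'k::field) mpoly \<Rightarrow> ('v, 'k) mpoly"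
  where "shifted_component r n x = (if r \<le> n then hom_component (n - r) x else 0)"

lemma shifted_component_sum: "shifted_component r n (\<Sum>x\<in>A. g x) = (\<Sum>x\<in>A. shifted_component r n (g x))"
  by (simp add: shifted_component_def hom_component_sum)

lemma keys_shifted_component:
  "t \<in> Poly_Mapping.keys (shifted_component r n x) \<Longrightarrow> monom_degree t + r = n"
  by (auto simp: shifted_component_def in_keys_iff lookup_hom_component split: if_splits)

lemma shifted_component_eq:
  assumes "\<And>t. t \<in> Poly_Mapping.keys x \<Longrightarrow> monom_degree t + r = n"
  shows "shifted_component r n x = x"
proof (cases "x = 0")
  case False
  then obtain t where "t \<in> Poly_Mapping.keys x" by (metis keys_eq_empty ex_in_conv)
  then have "r \<le> n" using assms by fastforce
  moreover have "homogeneous (n - r) x" using assms by (force simp: homogeneous_def)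
  ultimately show ?thesis by (simp add: shifted_component_def hom_component_homogeneous)
qed (simp add: shifted_component_def)

lemma shifted_component_mult:
  assumes g: "\<And>t. t \<in> Poly_Mapping.keys g \<Longrightarrow> monom_degree t + r = l"
  shows "g * shifted_component l n x = shifted_component r n (g * x)"
proof (cases "g = 0")
  case False
  then obtain t where "t \<in> Poly_Mapping.keys g" by (metis keys_eq_empty ex_in_conv)
  then have rl: "r \<le> l" using g by fastforce
  have hom: "homogeneous (l - r) g" using g by (force simp: homogeneous_def)
  show ?thesis
  proof (cases "l \<le> n")
    case True
    then have "n - r = (n - l) + (l - r)" using rl by simp
    then show ?thesis
      using True rl hom_component_mult(1)[OF hom, of "n - l" x] by (simp add: shifted_component_def mult.commute)
  next
    case False
    then show ?thesis
      using rl hom_component_mult(2)[OF hom, of "n - r" x] by (auto simp: shifted_component_def mult.commute)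
  qed
qed (simp add: shifted_component_def)

definition columns_in_range :: "'a::comm_ring_1 mat \<Rightarrow> 'a mat \<Rightarrow> bool"
  where "columns_in_range A X \<longleftrightarrow> (\<forall>q<dim_col X. \<exists>w\<in>carrier_vec (dim_col A). A *\<^sub>v w = col X q)"

lemma columns_in_rangeE:
  assumes "columns_in_range A X" "A \<in> carrier_mat n k" "X \<in> carrier_mat n c"
  obtains Y where "Y \<in> carrier_mat k c" "A * Y = X"
proof -
  obtain w where w: "\<And>q. q < c \<Longrightarrow> w q \<in> carrier_vec k" "\<And>q. q < c \<Longrightarrow> A *\<^sub>v w q = col X q"
    using assms unfolding columns_in_range_def by (metis carrier_matD(2))
  define Y where "Y = mat k c (\<lambda>(l, q). w q $ l)"
  have Y: "Y \<in> carrier_mat k c" by (simp add: Y_def)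
  have "col Y q = w q" if "q < c" for q
    using w(1)[OF that] that by (intro eq_vecI) (auto simp: Y_def)
  then have "col (A * Y) q = col X q" if "q < c" for q
    using that w(2) col_mult2[OF assms(2) Y] by simp
  then have "A * Y = X" using assms(2,3) Y by (intro mat_col_eqI) auto
  with Y show ?thesis by (rule that)
qed

text \<open>A solution of \<open>A * W = X\<close> need not be graded, but multiplication by a
  graded \<open>A\<close> commutes with taking components, so the graded part of \<open>W\<close> is
  again a solution.\<close>

lemma graded_lift:
  assumes A: "graded_mat rs ms A" and X: "graded_mat rs cs X" and range: "columns_in_range A X"
  obtains Y where "graded_mat ms cs Y" "A * Y = X"
proof -
  have car: "A \<in> carrier_mat (length rs) (length ms)" "X \<in> carrier_mat (length rs) (length cs)"
    using A X by (auto simp: graded_mat_def)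
  obtain W where W: "W \<in> carrier_mat (length ms) (length cs)" "A * W = X"
    using columns_in_rangeE[OF range car] .
  define Y where "Y = mat (length ms) (length cs) (\<lambda>(l, q). shifted_component (ms ! l) (cs ! q) (W $$ (l, q)))"
  have "graded_mat ms cs Y"
    by (auto simp: graded_mat_def Y_def dest: keys_shifted_component)
  moreover have "A * Y = X"
  proof (rule eq_matI)
    fix p q assume "p < dim_row X" "q < dim_col X"
    then have pq: "p < length rs" "q < length cs" using car by auto
    have "(A * Y) $$ (p, q) = (\<Sum>l<length ms. A $$ (p, l) * shifted_component (ms ! l) (cs ! q) (W $$ (l, q)))"
      using pq car by (auto simp: scalar_prod_def Y_def lessThan_atLeast0 intro!: sum.cong)
    also have "\<dots> = (\<Sum>l<length ms. shifted_component (rs ! p) (cs ! q) (A $$ (p, l) * W $$ (l, q)))"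
      using A pq by (intro sum.cong shifted_component_mult) (auto simp: graded_mat_def)
    also have "\<dots> = shifted_component (rs ! p) (cs ! q) ((A * W) $$ (p, q))"
      unfolding shifted_component_sum[symmetric]
      using pq car W(1) by (auto simp: scalar_prod_def lessThan_atLeast0 intro!: arg_cong[of _ _ "shifted_component _ _"] sum.cong)
    also have "\<dots> = X $$ (p, q)"
      unfolding W(2) using X pq by (intro shifted_component_eq) (auto simp: graded_mat_def)
    finally show "(A * Y) $$ (p, q) = X $$ (p, q)" .
  qed (use car in \<open>auto simp: Y_def\<close>)
  ultimately show ?thesis by (rule that)
qed

lemma graded_mat_mult:
  assumes A: "graded_mat rs ms A" and B: "graded_mat ms cs B"
  shows "graded_mat rs cs (A * B)"
proof -
  have car: "A \<in> carrier_mat (length rs) (length ms)" "B \<in> carrier_mat (length ms) (length cs)"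
    using A B by (auto simp: graded_mat_def)
  have "monom_degree t + rs ! p = cs ! q"
    if pq: "p < length rs" "q < length cs" and t: "t \<in> Poly_Mapping.keys ((A * B) $$ (p, q))" for p q t
  proof -
    have "(A * B) $$ (p, q) = (\<Sum>l<length ms. A $$ (p, l) * B $$ (l, q))"
      using pq car by (auto simp: scalar_prod_def lessThan_atLeast0 intro!: sum.cong)
    with t have "(\<Sum>l<length ms. Poly_Mapping.lookup (A $$ (p, l) * B $$ (l, q)) t) \<noteq> 0"
      by (simp add: in_keys_iff lookup_sum)
    then obtain l where l: "l < length ms" "t \<in> Poly_Mapping.keys (A $$ (p, l) * B $$ (l, q))"
      by (metis (no_types, lifting) in_keys_iff lessThan_iff sum.not_neutral_contains_not_neutral)
    then obtain t1 t2 where "t = t1 + t2" "t1 \<in> Poly_Mapping.keys (A $$ (p, l))" "t2 \<in> Poly_Mapping.keys (B $$ (l, q))"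
      using keys_mult[of "A $$ (p, l)" "B $$ (l, q)"] by auto
    then show ?thesis
      using A B pq l(1) unfolding graded_mat_def
      by (metis ab_semigroup_add_class.add_ac(1) add.commute monom_degree_add)
  qed
  then show ?thesis using car by (auto simp: graded_mat_def)
qed

lemma mult_unit_vec:
  assumes "A \<in> carrier_mat n c" "q < c"
  shows "A *\<^sub>v unit_vec c q = col (A :: 'a::comm_ring_1 mat) q"
  using col_mult2[OF assms(1) one_carrier_mat assms(2)] assms by simp

lemma columns_in_range_mult:
  assumes "A \<in> carrier_mat n k" "Y \<in> carrier_mat k c"
  shows "columns_in_range A (A * Y :: 'a::comm_ring_1 mat)"
  unfolding columns_in_range_def
  using col_mult2[OF assms] assms by auto

section \<open>Minimal resolutions: exactness and constant terms\<close>

locale graded_resolution =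
  fixes I :: "('v::finite, 'k::field) mpoly set" and ds \<phi>
  assumes resolution: "minimal_graded_free_resolution I ds \<phi>"
begin

lemma ds_0: "ds 0 = [0]"
  and differential_carrier: "\<phi> i \<in> carrier_mat (length (ds i)) (length (ds (Suc i)))"
  and lookup_differential:
    "p < length (ds i) \<Longrightarrow> q < length (ds (Suc i)) \<Longrightarrow> Poly_Mapping.lookup (\<phi> i $$ (p, q)) 0 = 0"
  and range_0: "{(\<phi> 0 *\<^sub>v w) $ 0 |w. w \<in> carrier_vec (length (ds 1))} = I"
  and exact: "{v \<in> carrier_vec (length (ds (Suc i))). \<phi> i *\<^sub>v v = 0\<^sub>v (length (ds i))} =
         {\<phi> (Suc i) *\<^sub>v w |w. w \<in> carrier_vec (length (ds (Suc (Suc i))))}"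
  and differential_graded: "graded_mat (ds i) (ds (Suc i)) (\<phi> i)"
  using resolution by (auto simp: minimal_graded_free_resolution_def graded_mat_def)

lemma columns_in_range_iff:
  assumes X: "X \<in> carrier_mat (length (ds (Suc i))) c"
  shows "columns_in_range (\<phi> (Suc i)) X \<longleftrightarrow> \<phi> i * X = 0\<^sub>m (length (ds i)) c"
proof -
  have "columns_in_range (\<phi> (Suc i)) X \<longleftrightarrow>
      (\<forall>q<c. col X q \<in> {\<phi> (Suc i) *\<^sub>v w |w. w \<in> carrier_vec (length (ds (Suc (Suc i))))})"
    using X differential_carrier[of "Suc i"] unfolding columns_in_range_def
    by (auto simp: Bex_def) metis+
  also have "\<dots> \<longleftrightarrow> (\<forall>q<c. \<phi> i *\<^sub>v col X q = 0\<^sub>v (length (ds i)))"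
    unfolding exact[symmetric] using X by auto
  also have "\<dots> \<longleftrightarrow> (\<forall>q<c. col (\<phi> i * X) q = col (0\<^sub>m (length (ds i)) c) q)"
    using col_mult2[OF differential_carrier X] by simp
  also have "\<dots> \<longleftrightarrow> \<phi> i * X = 0\<^sub>m (length (ds i)) c"
  proof
    show "\<phi> i * X = 0\<^sub>m (length (ds i)) c"
      if "\<forall>q<c. col (\<phi> i * X) q = col (0\<^sub>m (length (ds i)) c) q"
      using that X differential_carrier[of i] by (intro mat_col_eqI) (auto simp del: col_mult2)
  qed simp
  finally show ?thesis .
qed

lemma differential_square: "\<phi> i * \<phi> (Suc i) = 0\<^sub>m (length (ds i)) (length (ds (Suc (Suc i))))"
proof -
  have "columns_in_range (\<phi> (Suc i)) (\<phi> (Suc i) * 1\<^sub>m (length (ds (Suc (Suc i)))))"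
    using differential_carrier one_carrier_mat by (rule columns_in_range_mult)
  then have "columns_in_range (\<phi> (Suc i)) (\<phi> (Suc i))"
    using differential_carrier[of "Suc i"] by simp
  then show ?thesis using columns_in_range_iff[OF differential_carrier] by simp
qed

lemma lookup_differential_mult:
  assumes "h \<in> carrier_mat n (length (ds i))" "p < n" "q < length (ds (Suc i))"
  shows "Poly_Mapping.lookup ((h * \<phi> i) $$ (p, q)) 0 = 0"
  using mat_lookup_mult_zero[OF assms(1) differential_carrier assms(2,3)] lookup_differential assms by simp

lemma lookup_mult_differential:
  assumes "h \<in> carrier_mat (length (ds (Suc i))) c" "p < length (ds i)" "q < c"
  shows "Poly_Mapping.lookup ((\<phi> i * h) $$ (p, q)) 0 = 0"
  using mat_lookup_mult_zero[OF differential_carrier assms] lookup_differential assms by simp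

end

text \<open>
  Lifting the identity in both directions gives chain maps \<open>P\<close> and \<open>Q\<close> whose composite \<open>Q P\<close> is
  homotopic to the identity; the homotopy \<open>h\<close> contributes nothing to the constant terms, because the
  resolutions are minimal, so \<open>P\<close> has a left inverse modulo the variables.
\<close>

lemma resolution_comparison:
  assumes "minimal_graded_free_resolution I ds \<phi>" "minimal_graded_free_resolution I ds' \<phi>'"
  shows "\<exists>P Q h. graded_mat (ds' n) (ds n) P \<and> graded_mat (ds n) (ds' n) Q \<and>
    columns_in_range (\<phi>' n) (P * \<phi> n) \<and> columns_in_range (\<phi> n) (Q * \<phi>' n) \<and>
    h \<in> carrier_mat (length (ds (Suc n))) (length (ds n)) \<and>
    Q * P * \<phi> n = \<phi> n + \<phi> n * (h * \<phi> n) \<and>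
    (\<forall>i<length (ds n). \<forall>j<length (ds n).
      Poly_Mapping.lookup ((Q * P) $$ (i, j)) 0 = (if i = j then 1 else 0))"
proof (induction n)
  case 0
  interpret F: graded_resolution I ds \<phi> by standard fact
  interpret G: graded_resolution I ds' \<phi>' by standard fact
  \<comment> \<open>Both first differentials have image \<open>I\<close>, so each column of one lies
    in the range of the other; this is needed in both directions.\<close>
  have range: "columns_in_range (\<psi>' 0) (\<psi> 0)"
    if F: "graded_resolution I es \<psi>" and G: "graded_resolution I es' \<psi>'" for es es' \<psi> \<psi>'
    unfolding columns_in_range_def
  proof (intro allI impI)
    interpret F: graded_resolution I es \<psi> by fact
    interpret G: graded_resolution I es' \<psi>' by fact
    have car: "\<psi> 0 \<in> carrier_mat 1 (length (es 1))" "\<psi>' 0 \<in> carrier_mat 1 (length (es' 1))"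
      using F.differential_carrier[of 0] G.differential_carrier[of 0] F.ds_0 G.ds_0 by simp_all
    fix q assume "q < dim_col (\<psi> 0)"
    then have q: "q < length (es 1)" using car by simp
    have "(\<psi> 0 *\<^sub>v unit_vec (length (es 1)) q) $ 0 \<in> I"
      unfolding F.range_0[symmetric] by (auto intro!: exI[of _ "unit_vec (length (es 1)) q"])
    then obtain w where w: "w \<in> carrier_vec (length (es' 1))" "(\<psi>' 0 *\<^sub>v w) $ 0 = col (\<psi> 0) q $ 0"
      unfolding mult_unit_vec[OF car(1) q] G.range_0[symmetric] by auto
    then have "\<psi>' 0 *\<^sub>v w = col (\<psi> 0) q"
      using car q by (intro eq_vecI) (auto simp del: index_mult_mat_vec index_col)
    with w(1) show "\<exists>w\<in>carrier_vec (dim_col (\<psi>' 0)). \<psi>' 0 *\<^sub>v w = col (\<psi> 0) q"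
      using car by auto
  qed
  have car: "\<phi> 0 \<in> carrier_mat 1 (length (ds 1))" "\<phi>' 0 \<in> carrier_mat 1 (length (ds' 1))"
    using F.differential_carrier[of 0] G.differential_carrier[of 0] F.ds_0 G.ds_0 by simp_all
  have one: "graded_mat [0] [0] (1\<^sub>m 1)"
    by (auto simp: graded_mat_def)
  \<comment> \<open>Both complexes begin with the ring in degree 0, so the identity and the zero
    homotopy start the induction.\<close>
  show ?case
    using car one range[OF F.graded_resolution_axioms G.graded_resolution_axioms]
      range[OF G.graded_resolution_axioms F.graded_resolution_axioms]
    by (intro exI[of _ "1\<^sub>m 1"] exI[of _ "0\<^sub>m (length (ds 1)) 1"]) (simp add: F.ds_0 G.ds_0)
next
  case (Suc n)
  interpret F: graded_resolution I ds \<phi> by standard fact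
  interpret G: graded_resolution I ds' \<phi>' by standard fact
  \<comment> \<open>The homotopy identity is recorded only after composition with
    \<open>\<phi> n\<close>: the term with the preceding differential vanishes there, so nothing
    below \<open>\<phi> 0\<close> is mentioned.\<close>
  obtain P Q h where P: "graded_mat (ds' n) (ds n) P" and Q: "graded_mat (ds n) (ds' n) Q"
    and range: "columns_in_range (\<phi>' n) (P * \<phi> n)" "columns_in_range (\<phi> n) (Q * \<phi>' n)"
    and h: "h \<in> carrier_mat (length (ds (Suc n))) (length (ds n))"
    and hom: "Q * P * \<phi> n = \<phi> n + \<phi> n * (h * \<phi> n)"
    using Suc.IH by blast
  let ?a = "length (ds n)" and ?b = "length (ds (Suc n))" and ?c = "length (ds (Suc (Suc n)))"
  let ?a' = "length (ds' n)" and ?b' = "length (ds' (Suc n))" and ?c' = "length (ds' (Suc (Suc n)))"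
  obtain P' where P': "graded_mat (ds' (Suc n)) (ds (Suc n)) P'" "\<phi>' n * P' = P * \<phi> n"
    using graded_lift[OF G.differential_graded graded_mat_mult[OF P F.differential_graded] range(1)] .
  obtain Q' where Q': "graded_mat (ds (Suc n)) (ds' (Suc n)) Q'" "\<phi> n * Q' = Q * \<phi>' n"
    using graded_lift[OF F.differential_graded graded_mat_mult[OF Q G.differential_graded] range(2)] .
  note [simp] = F.differential_square G.differential_square
  have car [simp]: "\<phi> n \<in> carrier_mat ?a ?b" "\<phi> (Suc n) \<in> carrier_mat ?b ?c"
    "\<phi>' n \<in> carrier_mat ?a' ?b'" "\<phi>' (Suc n) \<in> carrier_mat ?b' ?c'"
    "P \<in> carrier_mat ?a' ?a" "Q \<in> carrier_mat ?a ?a'" "P' \<in> carrier_mat ?b' ?b" "Q' \<in> carrier_mat ?b ?b'"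
    "h \<in> carrier_mat ?b ?a"
    using F.differential_carrier G.differential_carrier P Q P'(1) Q'(1) h by (auto simp: graded_mat_def)
  note [simp] = mult_carrier_mat[OF car(7,2)] mult_carrier_mat[OF car(8,4)] mult_carrier_mat[OF car(9,1)]
    mult_carrier_mat[OF car(8,7)] mult_carrier_mat[OF car(6,5)]
    car[THEN carrier_matD(1)] car[THEN carrier_matD(2)]
  have "\<phi>' n * (P' * \<phi> (Suc n)) = \<phi>' n * P' * \<phi> (Suc n)"
    by (rule assoc_mult_mat[symmetric, of _ ?a' ?b' _ ?b _ ?c]) auto
  also have "\<dots> = P * (\<phi> n * \<phi> (Suc n))"
    unfolding P'(2) by (rule assoc_mult_mat[of _ ?a' ?a _ ?b _ ?c]) auto
  also have "\<dots> = 0\<^sub>m ?a' ?c" by (auto intro!: right_mult_zero_mat)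
  finally have range': "columns_in_range (\<phi>' (Suc n)) (P' * \<phi> (Suc n))"
    by (subst G.columns_in_range_iff[where c = ?c]) auto
  have "\<phi> n * (Q' * \<phi>' (Suc n)) = \<phi> n * Q' * \<phi>' (Suc n)"
    by (rule assoc_mult_mat[symmetric, of _ ?a ?b _ ?b' _ ?c']) auto
  also have "\<dots> = Q * (\<phi>' n * \<phi>' (Suc n))"
    unfolding Q'(2) by (rule assoc_mult_mat[of _ ?a ?a' _ ?b' _ ?c']) auto
  also have "\<dots> = 0\<^sub>m ?a ?c'" by (auto intro!: right_mult_zero_mat)
  finally have range'': "columns_in_range (\<phi> (Suc n)) (Q' * \<phi>' (Suc n))"
    by (subst F.columns_in_range_iff[where c = ?c']) auto
  \<comment> \<open>Under \<open>\<phi> n\<close> both \<open>g\<close> and \<open>Q' * P'\<close>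
    become \<open>Q * P * \<phi> n\<close>, so the columns of their difference are cycles, and
    lifting it gives the next homotopy \<open>h'\<close>.\<close>
  define g where "g = 1\<^sub>m ?b + h * \<phi> n"
  have hphi: "h * \<phi> n \<in> carrier_mat ?b ?b" by auto
  then have g: "g \<in> carrier_mat ?b ?b" by (simp add: g_def)
  have "\<phi> n * g = \<phi> n * 1\<^sub>m ?b + \<phi> n * (h * \<phi> n)"
    unfolding g_def by (rule mult_add_distrib_mat[of _ ?a ?b _ ?b]) auto
  then have phi_g: "\<phi> n * g = Q * P * \<phi> n" using hom by (simp add: right_mult_one_mat[OF car(1)])
  have "\<phi> n * (Q' * P') = \<phi> n * Q' * P'"
    by (rule assoc_mult_mat[symmetric, of _ ?a ?b _ ?b' _ ?b]) auto
  also have "\<dots> = Q * (\<phi>' n * P')"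
    unfolding Q'(2) by (rule assoc_mult_mat[of _ ?a ?a' _ ?b' _ ?b]) auto
  also have "\<dots> = Q * P * \<phi> n"
    unfolding P'(2) by (rule assoc_mult_mat[symmetric, of _ ?a ?a' _ ?a _ ?b]) auto
  finally have QP: "\<phi> n * (Q' * P') = \<phi> n * g" using phi_g by simp
  have "\<phi> n * (Q' * P' - g) = \<phi> n * (Q' * P') - \<phi> n * g"
    using g by (intro mult_minus_distrib_mat[of _ ?a ?b _ ?b]) auto
  also have "\<dots> = 0\<^sub>m ?a ?b"
    unfolding QP using mult_carrier_mat[OF car(1) g] by (intro eq_matI) auto
  finally have "columns_in_range (\<phi> (Suc n)) (Q' * P' - g)"
    using g by (subst F.columns_in_range_iff[where c = ?b]) auto
  then obtain h' where h': "h' \<in> carrier_mat ?c ?b" "\<phi> (Suc n) * h' = Q' * P' - g"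
    by (rule columns_in_rangeE[where n = ?b and k = ?c and c = ?b]) (use g in auto)
  have QP_eq: "Q' * P' = 1\<^sub>m ?b + h * \<phi> n + \<phi> (Suc n) * h'"
    unfolding h'(2) g_def by (rule eq_matI) auto
  have const: "Poly_Mapping.lookup ((Q' * P') $$ (i, j)) 0 = (if i = j then 1 else 0)"
    if ij: "i < ?b" "j < ?b" for i j
  proof -
    have "(Q' * P') $$ (i, j) = (if i = j then 1 else 0) + (h * \<phi> n) $$ (i, j) + (\<phi> (Suc n) * h') $$ (i, j)"
      unfolding QP_eq using ij h'(1) car(1,2,9) by (simp del: index_mult_mat(1))
    then show ?thesis
      using F.lookup_differential_mult[OF h ij] F.lookup_mult_differential[OF h'(1) ij]
      by (auto simp: lookup_add)
  qed
  have "Q' * P' * \<phi> (Suc n) = (1\<^sub>m ?b + h * \<phi> n) * \<phi> (Suc n) + \<phi> (Suc n) * h' * \<phi> (Suc n)"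
    unfolding QP_eq using mult_carrier_mat[OF car(2) h'(1)]
    by (intro add_mult_distrib_mat[of _ ?b ?b _ _ ?c]) auto
  also have "(1\<^sub>m ?b + h * \<phi> n) * \<phi> (Suc n) = 1\<^sub>m ?b * \<phi> (Suc n) + h * \<phi> n * \<phi> (Suc n)"
    by (intro add_mult_distrib_mat[of _ ?b ?b _ _ ?c]) auto
  also have "h * \<phi> n * \<phi> (Suc n) = h * (\<phi> n * \<phi> (Suc n))"
    by (rule assoc_mult_mat[of _ ?b ?a _ ?b _ ?c]) auto
  also have "\<dots> = 0\<^sub>m ?b ?c" by (auto intro!: right_mult_zero_mat)
  also have "1\<^sub>m ?b * \<phi> (Suc n) + 0\<^sub>m ?b ?c = \<phi> (Suc n)"
    by (simp add: left_mult_one_mat[OF car(2)] right_add_zero_mat[OF car(2)])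
  also have "\<phi> (Suc n) * h' * \<phi> (Suc n) = \<phi> (Suc n) * (h' * \<phi> (Suc n))"
    using h'(1) by (intro assoc_mult_mat[of _ ?b ?c _ ?b _ ?c]) auto
  finally have "Q' * P' * \<phi> (Suc n) = \<phi> (Suc n) + \<phi> (Suc n) * (h' * \<phi> (Suc n))" .
  moreover have "\<forall>i<?b. \<forall>j<?b. Poly_Mapping.lookup ((Q' * P') $$ (i, j)) 0 = (if i = j then 1 else 0)"
    using const by simp
  ultimately show ?case
    using P'(1) Q'(1) range' range'' h'(1)
    by (intro exI[of _ P'] exI[of _ Q'] exI[of _ h'] conjI)
qed

text \<open>The constant terms of the comparison maps are scalar matrices whose product is the
  identity. A nonzero constant term of a graded matrix joins basis elements of equal degree, so the
  count works degree by degree.\<close>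

lemma count_list_resolution_le:
  fixes I :: "('v::finite, 'k::field) mpoly set"
  assumes "minimal_graded_free_resolution I ds \<phi>" "minimal_graded_free_resolution I ds' \<phi>'"
  shows "count_list (ds n) j \<le> count_list (ds' n) j"
proof -
  obtain P Q :: "('v, 'k) mpoly mat" where P: "graded_mat (ds' n) (ds n) P" and Q: "graded_mat (ds n) (ds' n) Q"
    and const: "\<forall>i<length (ds n). \<forall>j<length (ds n).
      Poly_Mapping.lookup ((Q * P) $$ (i, j)) 0 = (if i = j then 1 else 0)"
    using resolution_comparison[OF assms, of n] by blast
  have car: "P \<in> carrier_mat (length (ds' n)) (length (ds n))" "Q \<in> carrier_mat (length (ds n)) (length (ds' n))"
    using P Q by (auto simp: graded_mat_def)
  show ?thesis
  proof (rule count_list_le_left_inverse)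
    show "(\<Sum>l<length (ds' n). Poly_Mapping.lookup (Q $$ (i, l)) 0 * Poly_Mapping.lookup (P $$ (l, i')) 0) =
        (if i = i' then 1 else 0)" if "i < length (ds n)" "i' < length (ds n)" for i i'
      using mat_lookup_mult_zero[OF car(2,1) that] const that by simp
    show "ds' n ! l = ds n ! i"
      if "l < length (ds' n)" "i < length (ds n)" "Poly_Mapping.lookup (P $$ (l, i)) 0 \<noteq> 0" for l i
      using P that by (force simp: graded_mat_def in_keys_iff)
  qed
qed

text \<open>Comparison in both directions gives all minimal resolutions the same counts, which
  justifies the \<open>THE\<close>.\<close>

lemma graded_betti_eq:
  assumes "minimal_graded_free_resolution I ds \<phi>"
  shows "graded_betti I i j = count_list (ds i) j"
  unfolding graded_betti_def
proof (rule the_equality)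
  show "\<exists>ds' \<phi>'. minimal_graded_free_resolution I ds' \<phi>' \<and> count_list (ds i) j = count_list (ds' i) j"
    using assms by blast
  fix b assume "\<exists>ds \<phi>. minimal_graded_free_resolution I ds \<phi> \<and> b = count_list (ds i) j"
  then obtain ds' \<phi>' where res: "minimal_graded_free_resolution I ds' \<phi>'" and b: "b = count_list (ds' i) j"
    by blast
  show "b = count_list (ds i) j"
    unfolding b using count_list_resolution_le[OF res assms] count_list_resolution_le[OF assms res]
    by (rule antisym)
qed

section \<open>Strongly generic sets and linear resolutions\<close>

lemma hom_component_ideal_gen:
  fixes C :: "('v::finite, 'k::field) mpoly set"
  assumes "\<And>y. y \<in> C \<Longrightarrow> homogeneous d y" "p \<in> ideal_gen C"
  shows "hom_component n p \<in> ideal_gen C"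
  using assms(2)
proof (induction rule: ring_module.span_induct_alt)
  case (step c x y)
  have "hom_component n (c * x) \<in> ideal_gen C"
  proof (cases "n < d")
    case True
    then show ?thesis
      using hom_component_mult(2)[OF assms(1)[OF step(1)], of n c] by (simp add: ring_module.span_zero)
  next
    case False
    then have "hom_component n (c * x) = hom_component (n - d) c * x"
      using hom_component_mult(1)[OF assms(1)[OF step(1)], of "n - d" c] by simp
    then show ?thesis using step(1) by (simp add: ring_module.span_scale[OF ring_module.span_base])
  qed
  with step(2) show ?case unfolding hom_component_add by (intro ring_module.span_add)
qed (simp add: ring_module.span_zero)

text \<open>
  A graded form of Nakayama's lemma: \<open>(C : z) = C + x (C : z)\<close> forces \<open>(C : z) = C\<close>, since the
  cofactor of \<open>x\<close> has smaller degree.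
\<close>

lemma homogeneous_descent:
  fixes C :: "('v::finite, 'k::field) mpoly set"
  assumes C: "\<And>y. y \<in> C \<Longrightarrow> homogeneous d y" and x: "homogeneous d x" and z: "homogeneous d z" and "d > 0"
    and step: "\<And>g. z * g \<in> ideal_gen C \<Longrightarrow> \<exists>g' u. g = x * g' + u \<and> u \<in> ideal_gen C \<and> z * g' \<in> ideal_gen C"
    and "z * g \<in> ideal_gen C"
  shows "g \<in> ideal_gen C"
proof -
  have component: "z * hom_component e g \<in> ideal_gen C" if "z * g \<in> ideal_gen C" for g e
    using hom_component_ideal_gen[OF C that, of "e + d"] hom_component_mult(1)[OF z, of e g]
    by (simp add: mult.commute)
  have "hom_component e g \<in> ideal_gen C" if "z * g \<in> ideal_gen C" for g e
    using that
  proof (induction e arbitrary: g rule: less_induct)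
    case (less e)
    obtain g' u where g: "g = x * g' + u" "u \<in> ideal_gen C" "z * g' \<in> ideal_gen C"
      using step[OF less.prems] by blast
    have "hom_component e (g' * x) \<in> ideal_gen C"
    proof (cases "e < d")
      case True
      then show ?thesis using hom_component_mult(2)[OF x, of e g'] by (simp add: ring_module.span_zero)
    next
      case False
      then have "hom_component e (g' * x) = hom_component (e - d) g' * x"
        using hom_component_mult(1)[OF x, of "e - d" g'] by simp
      moreover have "hom_component (e - d) g' \<in> ideal_gen C"
        using False \<open>d > 0\<close> g(3) by (intro less.IH) auto
      ultimately show ?thesis by (simp add: ideal_gen_mult_right)
    qed
    moreover have "hom_component e u \<in> ideal_gen C" using hom_component_ideal_gen[OF C g(2)] .
    ultimately show ?case
      unfolding g(1) hom_component_add by (simp add: mult.commute ring_module.span_add)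
  qed
  then have "(\<Sum>e\<in>monom_degree ` Poly_Mapping.keys g. hom_component e g) \<in> ideal_gen C"
    using assms(6) by (intro ring_module.span_sum) auto
  then show ?thesis by (simp add: sum_hom_components)
qed

text \<open>Induction from the end of the list. The last element \<open>y\<close> is cancelled
  modulo smaller and smaller subsets by descent on degrees; if \<open>y\<close> lies in
  \<open>C\<close>, an exchange with \<open>z\<close> reduces to the shorter list.\<close>

lemma koszul_list_nonzerodivisor:
  assumes "koszul_list d xs" "distinct xs" "d > 0"
    and "C \<subseteq> set xs" "z \<in> set xs - C" "z * g \<in> ideal_gen C"
  shows "g \<in> ideal_gen C"
  using assms
proof (induction xs arbitrary: C z g rule: rev_induct)
  case (snoc y xs)
  have hom: "homogeneous d x" if "x \<in> insert y (set xs)" for x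
    using snoc.prems(1) that by (auto simp: koszul_list_def)
  have "koszul_list d xs"
    using snoc.prems(1) unfolding koszul_list_def
    by (metis (no_types, lifting) UnCI append_eq_append_conv2 butlast_snoc length_append_singleton less_Suc_eq
        nth_butlast set_append take_butlast)
  then have IH: "g \<in> ideal_gen C" if "C \<subseteq> set xs" "z \<in> set xs - C" "z * g \<in> ideal_gen C" for C z g
    using snoc.IH snoc.prems(2,3) that by auto
  \<comment> \<open>Downward induction on \<open>C\<close>, starting at \<open>set xs\<close>.
    Adding one \<open>x\<close> gives \<open>g = x * g' + u\<close>, and \<open>IH\<close> cancels
    \<open>x\<close> from \<open>x * (y * g')\<close>, as \<open>homogeneous_descent\<close>
    asks.\<close>
  have y: "g \<in> ideal_gen C" if "C \<subseteq> set xs" "y * g \<in> ideal_gen C" for C g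
    using that
  proof (induction "card (set xs - C)" arbitrary: C g rule: less_induct)
    case less
    show ?case
    proof (cases "C = set xs")
      case True
      have "\<forall>x. x * (xs @ [y]) ! length xs \<in> ideal_gen (set (take (length xs) (xs @ [y]))) \<longrightarrow>
          x \<in> ideal_gen (set (take (length xs) (xs @ [y])))"
        using snoc.prems(1) by (auto simp: koszul_list_def)
      then show ?thesis using True less.prems by (simp add: mult.commute)
    next
      case False
      then obtain x where x: "x \<in> set xs - C" using less.prems by auto
      show ?thesis
      proof (rule homogeneous_descent[where d = d and x = x and z = y])
        fix g assume g: "y * g \<in> ideal_gen C"
        have "card (set xs - insert x C) < card (set xs - C)"
          using x by (intro psubset_card_mono) auto
        moreover have "y * g \<in> ideal_gen (insert x C)"
          using g ring_module.span_mono[of C "insert x C"] by auto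
        ultimately have "g \<in> ideal_gen (insert x C)" using less x by auto
        then obtain g' u where g': "g = x * g' + u" "u \<in> ideal_gen C" by (rule ideal_gen_insertE)
        have "x * (y * g') = y * g - y * u" by (simp add: g'(1) algebra_simps)
        also have "\<dots> \<in> ideal_gen C"
          by (rule ring_module.span_diff[OF g ring_module.span_scale[OF g'(2)]])
        finally have "y * g' \<in> ideal_gen C" using IH[OF less.prems(1) x] by blast
        with g' show "\<exists>g' u. g = x * g' + u \<and> u \<in> ideal_gen C \<and> y * g' \<in> ideal_gen C" by blast
      qed (use hom less.prems x \<open>d > 0\<close> in auto)
    qed
  qed
  have "y \<notin> set xs" using snoc.prems(2) by simp
  consider "z = y" | "z \<in> set xs" "y \<notin> C" | "z \<in> set xs" "y \<in> C" using snoc.prems by auto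
  then show ?case
  proof cases
    case 1
    then have "C \<subseteq> set xs" using snoc.prems by auto
    then show ?thesis using y 1 snoc.prems by blast
  next
    case 2
    then have "C \<subseteq> set xs" "z \<in> set xs - C" using snoc.prems by auto
    then show ?thesis using IH snoc.prems by blast
  next
    case 3
    \<comment> \<open>From \<open>z * g = y * h + u\<close>, cancelling \<open>y\<close> modulo
      \<open>insert z C'\<close> makes \<open>h\<close> a multiple of \<open>z\<close> up to the
      ideal of \<open>C'\<close>; then \<open>z\<close> is cancelled modulo
      \<open>C'\<close>.\<close>
    define C' where "C' = C - {y}"
    have C': "C = insert y C'" "C' \<subseteq> set xs" "z \<in> set xs - C'"
      using 3 snoc.prems by (auto simp: C'_def)
    obtain h u where h: "z * g = y * h + u" "u \<in> ideal_gen C'"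
      using snoc.prems(6) unfolding C'(1) by (rule ideal_gen_insertE)
    have "z * g \<in> ideal_gen (insert z C')"
      by (intro ideal_gen_mult_right ring_module.span_base) simp
    moreover have "u \<in> ideal_gen (insert z C')"
      using h(2) ring_module.span_mono[of C' "insert z C'"] by blast
    ultimately have "z * g - u \<in> ideal_gen (insert z C')" by (rule ring_module.span_diff)
    then have "y * h \<in> ideal_gen (insert z C')" by (simp add: h(1))
    moreover have "insert z C' \<subseteq> set xs" using C' by auto
    ultimately have "h \<in> ideal_gen (insert z C')" using y by blast
    then obtain h' v where h': "h = z * h' + v" "v \<in> ideal_gen C'" by (rule ideal_gen_insertE)
    have "z * (g - y * h') = y * v + u"
      using h(1) by (simp add: h'(1) algebra_simps)
    then have "z * (g - y * h') \<in> ideal_gen C'" using h(2) h'(2) by (simp add: ideal_gen_lincomb)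
    then have "g - y * h' \<in> ideal_gen C'" using IH C' by blast
    then have "g - y * h' \<in> ideal_gen C" using ring_module.span_mono[of C' C] C'(1) by auto
    moreover have "y * h' \<in> ideal_gen C"
      using C'(1) by (intro ideal_gen_mult_right ring_module.span_base) auto
    ultimately have "g - y * h' + y * h' \<in> ideal_gen C" by (rule ring_module.span_add)
    then show ?thesis by simp
  qed
qed simp

text \<open>Cancellation comes from a regular sequence on \<open>insert z C\<close>. For spanning,
  \<open>CARD('v)\<close> of the forms are linearly independent, since a dependence would put 1 into
  their proper ideal; by the dimension of the span of \<open>F\<close> they are a basis of
  it.\<close>

lemma strongly_generic_elements:
  fixes F :: "('v::finite, 'k::field) mpoly set"
  assumes "finite F" and F: "strongly_generic F"
  shows "generic_elements F CARD('v)"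
proof
  obtain d where d: "d > 0" "\<And>x. x \<in> F \<Longrightarrow> homogeneous d x"
    using F by (auto simp: strongly_generic_def)
  have reg: "\<exists>xs. distinct xs \<and> set xs = A \<and> regular_sequence xs" if "A \<subseteq> F" "card A \<le> CARD('v)" for A
    using F that finite_subset[OF that(1) \<open>finite F\<close>] by (simp add: strongly_generic_def generic_def)
  have nonzerodivisor: "g \<in> ideal_gen C"
    if "C \<subseteq> F" "z \<in> F - C" "card C < CARD('v)" "z * g \<in> ideal_gen C" for C z g
  proof -
    have "card (insert z C) \<le> CARD('v)"
      using that finite_subset[OF that(1) \<open>finite F\<close>] by simp
    moreover have "insert z C \<subseteq> F" using that by auto
    ultimately obtain xs where xs: "distinct xs" "set xs = insert z C" "regular_sequence xs"
      using reg by blast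
    have "koszul_list d xs"
      using xs d that by (auto simp: koszul_list_def regular_sequence_def)
    then show ?thesis
      by (rule koszul_list_nonzerodivisor[where d = d and xs = xs and z = z]) (use xs that d in auto)
  qed
  then show "g \<in> ideal_gen C"
    if "C \<subseteq> F" "z \<in> F - C" "card C < CARD('v)" "z * g \<in> ideal_gen C" for C z g
    using that .
  interpret V: vector_space "scale :: 'k \<Rightarrow> ('v, 'k) mpoly \<Rightarrow> _" by (rule vector_space_scale)
  have span: "V.span X \<subseteq> ideal_gen X" for X
    by (intro V.span_minimal V.subspaceI)
      (auto simp: scale_def ring_module.span_base ring_module.span_zero ring_module.span_add ring_module.span_scale)
  show "F \<subseteq> ideal_gen C" if C: "C \<subseteq> F" "card C = CARD('v)" for C
  proof -
    have indep: "V.independent C"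
      unfolding V.dependent_def
    proof safe
      fix z assume z: "z \<in> C" "z \<in> V.span (C - {z})"
      have "finite C" using C \<open>finite F\<close> finite_subset by auto
      then have "card (C - {z}) < CARD('v)" using z C by (metis card_Diff1_less)
      moreover have "z * 1 \<in> ideal_gen (C - {z})" using z span by auto
      ultimately have "1 \<in> ideal_gen (C - {z})"
        using nonzerodivisor[of "C - {z}" z 1] C z by blast
      then have "1 \<in> ideal_gen C" using ring_module.span_mono[of "C - {z}" C] by auto
      then have "x \<in> ideal_gen C" for x using ring_module.span_scale[of 1 C x] by simp
      moreover have "ideal_gen C \<noteq> UNIV" using reg[of C] C by (auto simp: regular_sequence_def)
      ultimately show False by auto
    qed
    obtain B where B: "B \<subseteq> F" "F \<subseteq> V.span B" "card B = V.dim F"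
      by (rule V.basis_exists)
    have "x \<in> V.span C" if "x \<in> F" for x
    proof (rule ccontr)
      assume x: "x \<notin> V.span C"
      then have "V.independent (insert x C)" using indep by (rule V.independent_insertI)
      moreover have "insert x C \<subseteq> V.span B" using that C(1) B(2) by auto
      ultimately have "card (insert x C) \<le> card B"
        using V.independent_span_bound[OF finite_subset[OF B(1) \<open>finite F\<close>]] by blast
      moreover have "card B = CARD('v)" using F B(3) by (simp add: strongly_generic_def)
      moreover have "x \<notin> C" using x V.span_base by blast
      ultimately show False using C finite_subset[OF C(1) \<open>finite F\<close>] by simp
    qed
    then show ?thesis using span[of C] by auto
  qed
qed (rule assms)

text \<open>Each syzygy step reproduces its own hypothesis and raises the degrees by
  \<open>d\<close>, so it can be repeated forever. Minimality holds because all entries have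
  positive degree.\<close>

lemma linear_resolution:
  fixes gs :: "('v::finite, 'k::field) mpoly list"
  assumes cq: "column_quotients d 1 (length gs) (\<lambda>p q. gs ! q)"
    and hom: "\<And>g. g \<in> set gs \<Longrightarrow> homogeneous \<delta> g" and "\<delta> > 0" "d > 0"
  shows "\<exists>ds \<phi>. minimal_graded_free_resolution (ideal_gen (set gs)) ds \<phi> \<and>
    (\<forall>i. set (ds (Suc i)) \<subseteq> {\<delta> + d * i})"
proof -
  \<comment> \<open>A state holds the size and the entries of one differential. Stage 0 is pinned to
    the row of generators, of degree \<open>\<delta>\<close>; all later entries have degree
    \<open>d\<close>.\<close>
  define valid where "valid n S \<longleftrightarrow>
    (case S of (k, r, M) \<Rightarrow> column_quotients d k r M \<and>
      (\<forall>p<k. \<forall>q<r. homogeneous (if n = 0 then \<delta> else d) (M p q)) \<and>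
      (n = 0 \<longrightarrow> k = 1 \<and> r = length gs \<and> M = (\<lambda>p q. gs ! q)))"
    for n :: nat and S :: "nat \<times> nat \<times> (nat \<Rightarrow> nat \<Rightarrow> ('v, 'k) mpoly)"
  define next_syz where "next_syz S S' \<longleftrightarrow>
    (case S of (k, r, M) \<Rightarrow> case S' of (k', r', M') \<Rightarrow> k' = r \<and>
      (\<forall>v. is_syzygy k r M v \<longleftrightarrow> (\<exists>w. \<forall>q<r. v q = (\<Sum>t<r'. w t * M' q t))))"
    for S S' :: "nat \<times> nat \<times> (nat \<Rightarrow> nat \<Rightarrow> ('v, 'k) mpoly)"
  have "\<exists>S. \<forall>n. valid n (S n) \<and> next_syz (S n) (S (Suc n))"
  proof (rule dependent_nat_choice)
    show "\<exists>S. valid 0 S" using cq hom by (auto simp: valid_def)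
    show "\<exists>S'. valid (Suc n) S' \<and> next_syz S S'" if S: "valid n S" for S n
    proof -
      obtain k r M where S_eq: "S = (k, r, M)" by (cases S)
      have "column_quotients d k r M"
        and "\<And>p q. p < k \<Longrightarrow> q < r \<Longrightarrow> homogeneous (if n = 0 then \<delta> else d) (M p q)"
        using S by (auto simp: valid_def S_eq)
      from syzygies_column_quotients[OF this] obtain r' M'
        where "column_quotients d r r' M'" "\<forall>q<r. \<forall>t<r'. homogeneous d (M' q t)"
          "\<forall>v. is_syzygy k r M v \<longleftrightarrow> (\<exists>w. \<forall>q<r. v q = (\<Sum>t<r'. w t * M' q t))"
        by blast
      then show ?thesis by (intro exI[of _ "(r, r', M')"]) (simp add: valid_def next_syz_def S_eq)
    qed
  qed
  then obtain S where S: "\<And>n. valid n (S n)" "\<And>n. next_syz (S n) (S (Suc n))" by auto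
  define k where "k n = fst (S n)" for n
  define r where "r n = fst (snd (S n))" for n
  define M where "M n = snd (snd (S n))" for n
  have S_eq: "S n = (k n, r n, M n)" for n by (simp add: k_def r_def M_def)
  have init: "k 0 = 1" "r 0 = length gs" "M 0 = (\<lambda>p q. gs ! q)"
    and M_hom: "\<And>n p q. p < k n \<Longrightarrow> q < r n \<Longrightarrow> homogeneous (if n = 0 then \<delta> else d) (M n p q)"
    using S(1) by (auto simp: valid_def S_eq)
  have k_Suc: "k (Suc n) = r n"
    and syz: "is_syzygy (k n) (r n) (M n) v \<longleftrightarrow> (\<exists>w. \<forall>q<r n. v q = (\<Sum>t<r (Suc n). w t * M (Suc n) q t))" for n v
    using S(2)[of n] by (auto simp: next_syz_def S_eq)
  define ds where "ds n = (case n of 0 \<Rightarrow> [0] | Suc i \<Rightarrow> replicate (r i) (\<delta> + d * i))" for n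
  define \<phi> where "\<phi> n = mat (k n) (r n) (\<lambda>(p, q). M n p q)" for n
  have len: "length (ds n) = k n" for n by (simp add: ds_def init k_Suc split: nat.split)
  have mult: "(\<phi> n *\<^sub>v w) $ p = (\<Sum>q<r n. w $ q * M n p q)"
    if "w \<in> carrier_vec (r n)" "p < k n" for n w p
    using that by (auto simp: \<phi>_def scalar_prod_def lessThan_atLeast0 mult.commute intro!: sum.cong)
  have "minimal_graded_free_resolution (ideal_gen (set gs)) ds \<phi>"
    unfolding minimal_graded_free_resolution_def
  proof (intro conjI allI impI ballI)
    show "ds 0 = [0]" by (simp add: ds_def)
    show "\<phi> i \<in> carrier_mat (length (ds i)) (length (ds (Suc i)))" for i
      by (simp add: len k_Suc \<phi>_def)
    fix i p q assume pq: "p < length (ds i)" "q < length (ds (Suc i))"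
    then have pq': "p < k i" "q < r i" by (simp_all add: len k_Suc)
    have entry: "\<phi> i $$ (p, q) = M i p q" using pq' by (simp add: \<phi>_def)
    show "monom_degree t + ds i ! p = ds (Suc i) ! q" if "t \<in> Poly_Mapping.keys (\<phi> i $$ (p, q))" for t
      using that M_hom[OF pq'] pq' unfolding entry
      by (auto simp: homogeneous_def ds_def init k_Suc split: nat.split)
    show "Poly_Mapping.lookup (\<phi> i $$ (p, q)) 0 = 0"
      using M_hom[OF pq'] \<open>\<delta> > 0\<close> \<open>d > 0\<close> unfolding entry
      by (auto simp: homogeneous_iff_lookup split: if_splits)
  next
    have "{(\<phi> 0 *\<^sub>v w) $ 0 |w. w \<in> carrier_vec (length gs)} = {x. \<exists>b. x = (\<Sum>j<length gs. b j * gs ! j)}"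
    proof (intro equalityI subsetI)
      fix x assume "x \<in> {(\<phi> 0 *\<^sub>v w) $ 0 |w. w \<in> carrier_vec (length gs)}"
      then obtain w where "x = (\<phi> 0 *\<^sub>v w) $ 0" "w \<in> carrier_vec (length gs)" by blast
      then have "x = (\<Sum>j<length gs. w $ j * gs ! j)" using mult[of w 0 0] by (simp add: init)
      then show "x \<in> {x. \<exists>b. x = (\<Sum>j<length gs. b j * gs ! j)}" by auto
    next
      fix x assume "x \<in> {x. \<exists>b. x = (\<Sum>j<length gs. b j * gs ! j)}"
      then obtain b where "x = (\<Sum>j<length gs. b j * gs ! j)" by auto
      then have "x = (\<phi> 0 *\<^sub>v vec (length gs) b) $ 0"
        using mult[of "vec (length gs) b" 0 0] by (simp add: init)
      then show "x \<in> {(\<phi> 0 *\<^sub>v w) $ 0 |w. w \<in> carrier_vec (length gs)}" by auto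
    qed
    then show "{(\<phi> 0 *\<^sub>v w) $ 0 |w. w \<in> carrier_vec (length (ds 1))} = ideal_gen (set gs)"
      using len[of 1] k_Suc[of 0] by (auto simp: ideal_gen_set_iff init)
  next
    fix i
    show "{v \<in> carrier_vec (length (ds (Suc i))). \<phi> i *\<^sub>v v = 0\<^sub>v (length (ds i))} =
         {\<phi> (Suc i) *\<^sub>v w |w. w \<in> carrier_vec (length (ds (Suc (Suc i))))}"
      unfolding len k_Suc
    proof (intro equalityI subsetI)
      fix v assume "v \<in> {v \<in> carrier_vec (r i). \<phi> i *\<^sub>v v = 0\<^sub>v (k i)}"
      then have v: "v \<in> carrier_vec (r i)" "\<phi> i *\<^sub>v v = 0\<^sub>v (k i)" by auto
      have "is_syzygy (k i) (r i) (M i) (\<lambda>q. v $ q)"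
        unfolding is_syzygy_def using mult[OF v(1)] v(2) by simp
      then obtain w where w: "\<And>q. q < r i \<Longrightarrow> v $ q = (\<Sum>t<r (Suc i). w t * M (Suc i) q t)"
        unfolding syz by auto
      have "v = \<phi> (Suc i) *\<^sub>v vec (r (Suc i)) w"
      proof (rule eq_vecI)
        show "v $ q = (\<phi> (Suc i) *\<^sub>v vec (r (Suc i)) w) $ q"
          if "q < dim_vec (\<phi> (Suc i) *\<^sub>v vec (r (Suc i)) w)" for q
          using that by (subst mult) (auto simp: \<phi>_def k_Suc w)
      qed (use v in \<open>simp add: \<phi>_def k_Suc\<close>)
      then show "v \<in> {\<phi> (Suc i) *\<^sub>v w |w. w \<in> carrier_vec (r (Suc i))}" by auto
    next
      fix v assume "v \<in> {\<phi> (Suc i) *\<^sub>v w |w. w \<in> carrier_vec (r (Suc i))}"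
      then obtain w where w: "w \<in> carrier_vec (r (Suc i))" "v = \<phi> (Suc i) *\<^sub>v w" by auto
      have v: "v \<in> carrier_vec (r i)" by (simp add: w(2) \<phi>_def k_Suc carrier_vecI)
      have "v $ q = (\<Sum>t<r (Suc i). w $ t * M (Suc i) q t)" if "q < r i" for q
        using mult[OF w(1), of q] that by (simp add: w(2) k_Suc)
      then have "is_syzygy (k i) (r i) (M i) (\<lambda>q. v $ q)"
        unfolding syz by (intro exI[of _ "\<lambda>t. w $ t"]) simp
      then have "\<phi> i *\<^sub>v v = 0\<^sub>v (k i)"
        unfolding is_syzygy_def using mult[OF v] by (intro eq_vecI) (auto simp: \<phi>_def)
      with v show "v \<in> {v \<in> carrier_vec (r i). \<phi> i *\<^sub>v v = 0\<^sub>v (k i)}" by simp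
    qed
  qed
  moreover have "set (ds (Suc i)) \<subseteq> {\<delta> + d * i}" for i by (auto simp: ds_def)
  ultimately show ?thesis by blast
qed

text \<open>A generating subset of least cardinality is irredundant. As \<open>I\<close> is nonzero,
  it is nonempty, so the degree really occurs.\<close>

lemma generated_in_single_degree:
  fixes I :: "('v::finite, 'k::field) mpoly set"
  assumes "finite G" "ideal_gen G = I" "\<And>g. g \<in> G \<Longrightarrow> homogeneous \<delta> g" "I \<noteq> {0}"
  shows "generated_in_degrees I {\<delta>}"
proof -
  obtain H where H: "H \<subseteq> G" "ideal_gen H = I"
    and min: "\<And>H'. H' \<subseteq> G \<Longrightarrow> ideal_gen H' = I \<Longrightarrow> card H \<le> card H'"
    using ex_has_least_nat[of "\<lambda>H. H \<subseteq> G \<and> ideal_gen H = I" G card] assms(2) by auto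
  have fin: "finite H" using H(1) assms(1) finite_subset by auto
  have "ideal_gen H' \<noteq> I" if "H' \<subset> H" for H'
    using min[of H'] psubset_card_mono[OF fin that] H(1) that by auto
  moreover have "H \<noteq> {}" using H(2) assms(4) by auto
  ultimately show ?thesis
    unfolding generated_in_degrees_def using fin H assms(3)
    by (intro exI[of _ H] exI[of _ "\<lambda>_. \<delta>"]) auto
qed

section \<open>Degrees and nonvanishing of the generators\<close>

lemma fold_gens_nonempty:
  assumes "finite S" "a \<le> (\<Sum>x\<in>S. m x)"
  shows "fold_gens S m a \<noteq> {}"
  using assms
proof (induction S arbitrary: a rule: finite_induct)
  case empty
  then show ?case by (simp add: fold_gens_0)
next
  case (insert s S)
  then have "fold_gens S m (a - min (m s) a) \<noteq> {}" by (intro insert.IH) auto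
  then show ?case using insert.hyps by (subst fold_gens_insert) auto
qed

lemma homogeneous_fold_gens:
  fixes S :: "('v::finite, 'k::field) mpoly set"
  assumes "\<And>x. x \<in> S \<Longrightarrow> homogeneous d x" "g \<in> fold_gens S m a"
  shows "homogeneous (d * a) g"
proof -
  obtain e where e: "g = (\<Prod>x\<in>S. x ^ e x)" "(\<Sum>x\<in>S. e x) = a"
    using assms(2) by (auto simp: fold_gens_def)
  have "homogeneous (\<Sum>x\<in>S. d * e x) g"
    unfolding e(1) using assms(1) by (intro homogeneous_prod homogeneous_power)
  then show ?thesis by (simp add: e(2) flip: sum_distrib_left)
qed

text \<open>With \<open>C = {}\<close>, each form is a nonzerodivisor of the ring, so it can be
  cancelled from a vanishing product until \<open>1 = 0\<close> remains.\<close>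

lemma (in generic_elements) fold_gens_nonzero:
  assumes "S \<subseteq> F" "N > 0" "(1 :: 'a) \<noteq> 0"
  shows "0 \<notin> fold_gens S m a"
proof -
  have cancel: "g = 0" if "x \<in> F" "x ^ n * g = 0" for x g n
    using that(2)
  proof (induction n)
    case (Suc n)
    then have "x * (x ^ n * g) \<in> ideal_gen {}" by (simp add: mult.assoc)
    then have "x ^ n * g \<in> ideal_gen {}"
      using nonzerodivisor[of "{}" x] that(1) assms(2) by auto
    then show ?case using Suc.IH by simp
  qed simp
  have "finite S" using assms(1) by (rule finite_subset_elements)
  then have "(\<Prod>x\<in>S. x ^ e x) \<noteq> 0" for e
    using assms(1)
  proof (induction S rule: finite_induct)
    case (insert x S)
    then show ?case using cancel[of x "e x" "\<Prod>x\<in>S. x ^ e x"] by auto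
  qed (use assms(3) in simp)
  then show ?thesis by (auto simp: fold_gens_def)
qed

text \<open>A list of generators is a matrix with one row. Any enumeration of \<open>D\<close> is a
  \<open>koszul_list\<close>, since its proper prefixes have fewer than \<open>N\<close>
  elements.\<close>

lemma linear_quotients_column_quotients:
  fixes gs :: "('v::finite, 'k::field) mpoly list"
  assumes gen: "generic_elements F N" and lq: "generic_elements.linear_quotients F N {} gs"
    and hom: "\<And>x. x \<in> F \<Longrightarrow> homogeneous d x"
  shows "column_quotients d 1 (length gs) (\<lambda>p q. gs ! q)"
  unfolding column_quotients_def
proof (intro allI impI)
  interpret generic_elements F N by fact
  fix i assume i: "i < length gs"
  obtain D where D: "D \<subseteq> F" "card D \<le> N"
    "ideal_colon (ideal_gen (set (take i gs))) (gs ! i) = ideal_gen D"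
    using lq i by (auto simp: linear_quotients_def)
  obtain ys where ys: "set ys = D" "distinct ys"
    using finite_distinct_list[OF finite_subset_elements[OF D(1)]] by auto
  have "koszul_list d ys"
    unfolding koszul_list_def
  proof (intro conjI ballI allI impI)
    show "homogeneous d y" if "y \<in> set ys" for y using that ys D hom by auto
    fix j x assume j: "j < length ys" and x: "x * ys ! j \<in> ideal_gen (set (take j ys))"
    have "card (set (take j ys)) = j" using ys(2) j by (simp add: distinct_card)
    moreover have "length ys \<le> N" using ys D(2) distinct_card[OF ys(2)] by simp
    moreover have "ys ! j \<notin> set (take j ys)"
      using ys(2) j by (auto simp: in_set_conv_nth nth_eq_iff_index_eq)
    moreover have "set (take j ys) \<subseteq> F" using ys D set_take_subset[of j ys] by auto
    moreover have "ys ! j \<in> F" using ys D j by auto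
    ultimately show "x \<in> ideal_gen (set (take j ys))"
      using nonzerodivisor[of "set (take j ys)" "ys ! j" x] j x by (simp add: mult.commute)
  qed
  moreover have "(\<exists>c. \<forall>p<1::nat. x * gs ! i = (\<Sum>l<i. c l * gs ! l)) \<longleftrightarrow> x \<in> ideal_gen (set ys)" for x
  proof -
    have "x \<in> ideal_gen (set ys) \<longleftrightarrow> x * gs ! i \<in> ideal_gen (set (take i gs))"
      unfolding ys(1) D(3)[symmetric] by (simp add: ideal_colon_def)
    also have "\<dots> \<longleftrightarrow> (\<exists>c. x * gs ! i = (\<Sum>l<i. c l * gs ! l))"
      unfolding ideal_gen_set_iff using i by (simp add: min_def)
    finally show ?thesis by simp
  qed
  ultimately show "\<exists>ys. koszul_list d ys \<and>
      (\<forall>x. (\<exists>c. \<forall>p<1::nat. x * gs ! i = (\<Sum>l<i. c l * gs ! l)) \<longleftrightarrow> x \<in> ideal_gen (set ys))" by blast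
qed

lemma koszul_stranded_fold_ideal:
  fixes F :: "('v::finite, 'k::field) mpoly set"
  assumes gen: "generic_elements F CARD('v)" and "d > 0" "a > 0"
    and hom: "\<And>x. x \<in> F \<Longrightarrow> homogeneous d x" and "a \<le> (\<Sum>x\<in>F. m x)"
  shows "koszul_stranded (ideal_gen (fold_gens F m a))"
proof -
  interpret generic_elements F "CARD('v)" by fact
  let ?I = "ideal_gen (fold_gens F m a)"
  obtain gs where gs: "linear_quotients {} gs" "set gs \<subseteq> fold_gens F m a" "ideal_gen (set gs) = ?I"
    using linear_quotients_exist[of F "{}" m a] by auto
  have gs_hom: "homogeneous (d * a) g" if "g \<in> set gs" for g
    using homogeneous_fold_gens[OF hom, of F g m a] gs(2) that by auto
  have "0 \<notin> fold_gens F m a" by (rule fold_gens_nonzero) auto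
  then have "?I \<noteq> {0}"
    using fold_gens_nonempty[OF finite_elements assms(5)] ring_module.span_superset[of "fold_gens F m a"] by auto
  then have degrees: "generated_in_degrees ?I {d * a}"
    using generated_in_single_degree[of "set gs" ?I "d * a"] gs(3) gs_hom by auto
  have "column_quotients d 1 (length gs) (\<lambda>p q. gs ! q)"
    using linear_quotients_column_quotients[OF gen gs(1) hom] .
  from linear_resolution[OF this gs_hom] obtain ds \<phi>
    where res: "minimal_graded_free_resolution ?I ds \<phi>" and ds: "\<And>i. set (ds (Suc i)) \<subseteq> {d * a + d * i}"
    using assms(2,3) gs(3) by auto
  have "j = d * a + d * (i - 1)" if "i \<ge> 1" "graded_betti ?I i j \<noteq> 0" for i j
  proof -
    have "j \<in> set (ds i)"
      using that(2) unfolding graded_betti_eq[OF res] by (simp add: count_list_0_iff)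
    then show ?thesis using ds[of "i - 1"] that(1) by auto
  qed
  then show ?thesis
    unfolding koszul_stranded_def using degrees assms(2,3)
    by (intro exI[of _ "{d * a}"] conjI exI[of _ d]) auto
qed

text \<open>The theorem indexes forms by positions, while the inductions move forms between sets.
  Injectivity of \<open>f\<close> translates between the two.\<close>

lemma fold_gens_image:
  assumes "inj_on f A" "finite A" and m: "\<And>i. i \<in> A \<Longrightarrow> m' (f i) = m i"
  shows "{\<Prod>i\<in>A. f i ^ e i |e. (\<forall>i\<in>A. e i \<le> m i) \<and> (\<Sum>i\<in>A. e i) = a} = fold_gens (f ` A) m' a"
proof (intro equalityI subsetI)
  fix g assume "g \<in> {\<Prod>i\<in>A. f i ^ e i |e. (\<forall>i\<in>A. e i \<le> m i) \<and> (\<Sum>i\<in>A. e i) = a}"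
  then obtain e where e: "g = (\<Prod>i\<in>A. f i ^ e i)" "\<forall>i\<in>A. e i \<le> m i" "(\<Sum>i\<in>A. e i) = a" by blast
  have inv: "the_inv_into A f (f i) = i" if "i \<in> A" for i
    using assms(1) that by (rule the_inv_into_f_f)
  show "g \<in> fold_gens (f ` A) m' a"
    unfolding fold_gens_def mem_Collect_eq using e assms(1)
    by (intro exI[of _ "\<lambda>x. e (the_inv_into A f x)"]) (simp add: prod.reindex sum.reindex inv m)
next
  fix g assume "g \<in> fold_gens (f ` A) m' a"
  then obtain e where e: "g = (\<Prod>x\<in>f ` A. x ^ e x)" "\<forall>x\<in>f ` A. e x \<le> m' x" "(\<Sum>x\<in>f ` A. e x) = a"
    by (auto simp: fold_gens_def)
  then show "g \<in> {\<Prod>i\<in>A. f i ^ e i |e. (\<forall>i\<in>A. e i \<le> m i) \<and> (\<Sum>i\<in>A. e i) = a}"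
    using assms(1) m by (auto simp: prod.reindex sum.reindex intro!: exI[of _ "e \<circ> f"])
qed

theorem proposition3p2:
  fixes f :: "nat \<Rightarrow> ('v::finite, 'k::field) mpoly"
    and m :: "nat \<Rightarrow> nat"
    and s a :: nat
  assumes "infinite (UNIV :: 'k set)"
    and "inj_on f {1..s}"
    and "strongly_generic (f ` {1..s})"
    and "a > 0"
    and "\<And>i. i \<in> {1..s} \<Longrightarrow> m i > 0"
    and "a \<le> (\<Sum>i=1..s. m i)"
  shows "fold_ideal s f m a =
      (\<Inter>c\<in>{1..s}. \<Inter>A\<in>{A. A \<subseteq> {1..s} \<and> card A = c}. ideal_power (ideal_gen (f ` A)) (mu s m a A)) \<and>
    ideal_colon (fold_ideal s f (m(s := m s + 1)) (a + 1)) (f s) = fold_ideal s f m a \<and>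
    koszul_stranded (fold_ideal s f m a)"
proof -
  define F where "F = f ` {1..s}"
  define m' where "m' x = m (the_inv_into {1..s} f x)" for x
  have m': "m' (f i) = m i" if "i \<in> {1..s}" for i
    unfolding m'_def using the_inv_into_f_f[OF assms(2) that] by simp
  have fin: "finite F" by (simp add: F_def)
  have gen: "generic_elements F CARD('v)"
    using strongly_generic_elements[OF fin] assms(3) by (simp add: F_def)
  interpret generic_elements F "CARD('v)" by (rule gen)
  obtain d where d: "d > 0" "\<And>x. x \<in> F \<Longrightarrow> homogeneous d x"
    using assms(3) by (auto simp: strongly_generic_def F_def)
  have fold: "fold_ideal s f m a = ideal_gen (fold_gens F m' a)"
    unfolding fold_ideal_def F_def using fold_gens_image[of f "{1..s}" m' m a] assms(2) m' by simp
  have s: "s \<in> {1..s}" using assms(4,6) by (cases "s = 0") auto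
  then have fs: "f s \<in> F" by (simp add: F_def)
  \<comment> \<open>Raised by one so that the decrement in \<open>colon_fold_ideal\<close> returns
    exactly \<open>m'\<close>, just as it takes \<open>a + 1\<close> back to
    \<open>a\<close>.\<close>
  let ?m = "m'(f s := m' (f s) + 1)"
  have "?m (f i) = (m(s := m s + 1)) i" if "i \<in> {1..s}" for i
    using that assms(2) m' s by (auto dest: inj_onD)
  then have fold_Suc: "fold_ideal s f (m(s := m s + 1)) (a + 1) = ideal_gen (fold_gens F ?m (a + 1))"
    unfolding fold_ideal_def F_def using fold_gens_image[of f "{1..s}" ?m "m(s := m s + 1)" "a + 1"] assms(2) by simp
  have sum_eq: "(\<Sum>x\<in>F - f ` A. m' x) = (\<Sum>i\<in>{1..s} - A. m i)" if "A \<subseteq> {1..s}" for A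
  proof -
    have "F - f ` A = f ` ({1..s} - A)"
      unfolding F_def using assms(2) that by (simp add: inj_on_image_set_diff)
    moreover have "inj_on f ({1..s} - A)" using assms(2) by (rule inj_on_subset) auto
    ultimately show ?thesis using m' by (simp add: sum.reindex)
  qed
  have power: "ideal_power_plus (f ` A) {} (a - (\<Sum>x\<in>F - f ` A. m' x)) =
      ideal_power (ideal_gen (f ` A)) (mu s m a A)" if "A \<subseteq> {1..s}" for A
    using sum_eq[OF that] by (simp add: ideal_power_plus_def ideal_power_ideal_gen mu_def)
  \<comment> \<open>\<open>fold_bound\<close> includes the empty set, the theorem does not. Since
    \<open>a\<close> is at most the total multiplicity, its exponent is 0 and its term is the whole
    ring.\<close>
  have trivial: "ideal_power (ideal_gen (f ` {})) (mu s m a {}) = UNIV"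
    using assms(6) by (simp add: mu_def)
  have "ideal_gen (fold_gens F m' a) = fold_bound F {} m' a"
    using fold_bound_eq[of F "{}" m' a] by simp
  also have "\<dots> = (\<Inter>A\<in>Pow {1..s}. ideal_power_plus (f ` A) {} (a - (\<Sum>x\<in>F - f ` A. m' x)))"
    unfolding fold_bound_def by (simp add: F_def image_Pow_surj[symmetric] image_image)
  also have "\<dots> = (\<Inter>A\<in>Pow {1..s}. ideal_power (ideal_gen (f ` A)) (mu s m a A))"
    using power by (intro INF_cong) auto
  also have "\<dots> = (\<Inter>c\<in>{1..s}. \<Inter>A\<in>{A. A \<subseteq> {1..s} \<and> card A = c}. ideal_power (ideal_gen (f ` A)) (mu s m a A))"
  proof (intro equalityI subsetI INT_I)
    fix g A
    assume g: "g \<in> (\<Inter>c\<in>{1..s}. \<Inter>A\<in>{A. A \<subseteq> {1..s} \<and> card A = c}. ideal_power (ideal_gen (f ` A)) (mu s m a A))"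
      and "A \<in> Pow {1..s}"
    then have A: "A \<subseteq> {1..s}" by simp
    show "g \<in> ideal_power (ideal_gen (f ` A)) (mu s m a A)"
    proof (cases "A = {}")
      case False
      then have "card A \<in> {1..s}"
        using A card_mono[OF _ A] finite_subset[OF A] by (simp add: Suc_le_eq card_gt_0_iff)
      with g A show ?thesis by blast
    qed (simp only: trivial UNIV_I)
  qed auto
  finally have intersection: "fold_ideal s f m a =
    (\<Inter>c\<in>{1..s}. \<Inter>A\<in>{A. A \<subseteq> {1..s} \<and> card A = c}. ideal_power (ideal_gen (f ` A)) (mu s m a A))"
    unfolding fold .
  have rec: "?m(f s := ?m (f s) - 1) = m'" by auto
  have "g * f s \<in> ideal_gen (fold_gens F ?m (a + 1)) \<longleftrightarrow> g \<in> ideal_gen (fold_gens F m' a)" for g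
  proof
    assume "g * f s \<in> ideal_gen (fold_gens F ?m (a + 1))"
    then show "g \<in> ideal_gen (fold_gens F m' a)"
      using colon_fold_ideal[of F "{}" "f s" ?m "a + 1" g] fs by (simp add: mult.commute)
  next
    assume "g \<in> ideal_gen (fold_gens F m' a)"
    then have "f s * g \<in> ideal_gen ((*) (f s) ` fold_gens F m' a)" by (rule times_mem_ideal_gen_image)
    also have "\<dots> \<subseteq> ideal_gen (fold_gens F ?m (a + 1))"
      using fold_gens_rec[OF fin fs, of ?m "a + 1"] unfolding rec
      by (intro ring_module.span_mono) auto
    finally show "g * f s \<in> ideal_gen (fold_gens F ?m (a + 1))" by (simp add: mult.commute)
  qed
  then have colon: "ideal_colon (fold_ideal s f (m(s := m s + 1)) (a + 1)) (f s) = fold_ideal s f m a"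
    unfolding fold_Suc fold by (simp add: ideal_colon_def)
  have "(\<Sum>x\<in>F. m' x) = (\<Sum>i=1..s. m i)" using sum_eq[of "{}"] by simp
  then have "koszul_stranded (fold_ideal s f m a)"
    unfolding fold using assms(4,6) d gen by (intro koszul_stranded_fold_ideal[where d = d]) auto
  with intersection colon show ?thesis by blast
qed

end
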